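(* Let $\mathcal{G}$ be a connected metric graph with vertex set $\mathsf{V}$, and let $\alpha\in[0,\infty)^{\mathsf{V}}$ be not identically zero. Write $|\alpha|_1=\sum_{\mathsf{v}\in\mathsf{V}}\alpha_{\mathsf{v}}$. Then $$T(\mathcal{G},\alpha)\leq T(\mathcal{J},\{0,|\alpha|_1\})=\frac{|\mathcal{G}|^3}{3}+\frac{|\mathcal{G}|^2}{|\alpha|_1},$$ where $\mathcal{J}$ is the path graph (interval) of length $|\mathcal{G}|$ with a $\delta$-vertex condition of strength $|\alpha|_1$ at one end vertex and a Neumann condition (strength $0$) at the other one. Equality holds if and only if $\mathcal{G}=\mathcal{J}$ with the described vertex conditions.
   Context: A metric graph $\mathcal{G}$ is a finite collection of intervals glued together at their endpoints according to a finite combinatorial graph $(\mathsf{V},\mathsf{E})$ (loops and multiple edges allowed); each edge $\mathsf{e}\in\mathsf{E}$ is identified with $[0,\ell_{\mathsf{e}}]$, $\ell_{\mathsf{e}}\in(0,\infty)$. The total length is $|\mathcal{G}|=\sum_{\mathsf{e}\in\mathsf{E}}\ell_{\mathsf{e}}$. $\mathcal{G}$ is connected if any two points are joined by a continuous path. $\mathsf{E}_{\mathsf{v}}$ is the collection of edges incident to $\mathsf{v}$ (a loop at $\mathsf{v}$ counted twice, once for each endpoint), $u_{\mathsf{e}}$ is the restriction of $u$ to $\mathsf{e}$, and $\frac{\partial u_{\mathsf{e}}}{\partial n}(\mathsf{v})$ is the derivative of $u_{\mathsf{e}}$ at the endpoint $\mathsf{v}$ in the direction pointing into $\mathsf{v}$.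 For $\alpha\in\mathbb{R}^{\mathsf{V}}$ (the strengths), the operator $-\Delta_{\mathcal{G},\alpha}$ in $L^2(\mathcal{G})$ acts as $u\mapsto -u''$ on each edge, on functions that are edgewise in $H^2(0,\ell_{\mathsf{e}})$, continuous at every vertex, and satisfy the $\delta$-vertex condition $\sum_{\mathsf{e}\in\mathsf{E}_{\mathsf{v}}}\frac{\partial u_{\mathsf{e}}}{\partial n}(\mathsf{v})+\alpha_{\mathsf{v}}u(\mathsf{v})=0$ for all $\mathsf{v}\in\mathsf{V}$. The torsion function of $(\mathcal{G},\alpha)$ is the unique solution $\upsilon$ of $-\Delta_{\mathcal{G},\alpha}\upsilon=1$ (it exists and is strictly positive when $\mathcal{G}$ is connected and $\alpha\in[0,\infty)^{\mathsf{V}}$ is not identically zero), and the torsional rigidity is $T(\mathcal{G},\alpha)=\int_{\mathcal{G}}\upsilon(x)\,\mathrm{d}x$. For a path graph with one edge, $T(\mathcal{J},\{a,b\})$ denotes the torsional rigidity with strengths $a,b$ at the two end vertices. Graphs are identified up to isometry and up to inserting or removing vertices of degree two with strength $0$ (which changes neither the operator nor $T$); the equality $\mathcal{G}=\mathcal{J}$ is understood in this sense. *)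

theory Defs
  imports "HOL-Analysis.Analysis" "Graph_Theory.Digraph"
begin

section \<open>Metric graphs\<close>

text \<open>
  The combinatorial graph is a finite multidigraph. The direction of an edge \<open>e\<close> only records
  which of its ends is \<open>0\<close> (the tail) and which is \<open>l e\<close> (the head) in the identification of
  \<open>e\<close> with the interval \<open>[0, l e]\<close>; none of the notions below depends on this choice.
  At least one edge is required, so that the total length is positive.
\<close>

locale metric_graph = fin_digraph G for G :: "('v, 'e) pre_digraph" +
  fixes l :: "'e \<Rightarrow> real"
  assumes arcs_nonempty: "arcs G \<noteq> {}"
    and length_pos: "\<And>e. e \<in> arcs G \<Longrightarrow> 0 < l e"

definition total_length :: "('v, 'e) pre_digraph \<Rightarrow> ('e \<Rightarrow> real) \<Rightarrow> real" where
  "total_length G l = (\<Sum>e\<in>arcs G. l e)"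

text \<open>
  The quotient of the disjoint union of the intervals \<open>[0, l e]\<close> is represented concretely: a point
  is either a vertex or lies in the open interval \<open>(0, l e)\<close> of exactly one edge. The map
  \<open>edge_pt G l e\<close>, restricted to \<open>[0, l e]\<close>, is the quotient map on the edge \<open>e\<close>.
\<close>

datatype ('v, 'e) point = Vertex 'v | Interior 'e real

definition points :: "('v, 'e) pre_digraph \<Rightarrow> ('e \<Rightarrow> real) \<Rightarrow> ('v, 'e) point set" where
  "points G l = Vertex ` verts G \<union> {Interior e x | e x. e \<in> arcs G \<and> 0 < x \<and> x < l e}"

definition edge_pt :: "('v, 'e) pre_digraph \<Rightarrow> ('e \<Rightarrow> real) \<Rightarrow> 'e \<Rightarrow> real \<Rightarrow> ('v, 'e) point" where
  "edge_pt G l e x =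
    (if x = 0 then Vertex (tail G e) else if x = l e then Vertex (head G e) else Interior e x)"

definition graph_topology ::
    "('v, 'e) pre_digraph \<Rightarrow> ('e \<Rightarrow> real) \<Rightarrow> ('v, 'e) point topology" where
  "graph_topology G l = topology (\<lambda>U. U \<subseteq> points G l \<and>
     (\<forall>e\<in>arcs G. openin (top_of_set {0..l e}) {x\<in>{0..l e}. edge_pt G l e x \<in> U}))"

lemma openin_graph_topology:
  "openin (graph_topology G l) U \<longleftrightarrow> U \<subseteq> points G l \<and>
     (\<forall>e\<in>arcs G. openin (top_of_set {0..l e}) {x\<in>{0..l e}. edge_pt G l e x \<in> U})"
proof -
  have "istopology (\<lambda>U. U \<subseteq> points G l \<and>
     (\<forall>e\<in>arcs G. openin (top_of_set {0..l e}) {x\<in>{0..l e}. edge_pt G l e x \<in> U}))"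
    unfolding istopology_def
  proof (intro conjI allI impI ballI)
    fix S T e
    assume S: "S \<subseteq> points G l \<and>
        (\<forall>e\<in>arcs G. openin (top_of_set {0..l e}) {x\<in>{0..l e}. edge_pt G l e x \<in> S})"
      and T: "T \<subseteq> points G l \<and>
        (\<forall>e\<in>arcs G. openin (top_of_set {0..l e}) {x\<in>{0..l e}. edge_pt G l e x \<in> T})"
    show "S \<inter> T \<subseteq> points G l" using S by blast
    assume e: "e \<in> arcs G"
    have "{x\<in>{0..l e}. edge_pt G l e x \<in> S \<inter> T} =
        {x\<in>{0..l e}. edge_pt G l e x \<in> S} \<inter> {x\<in>{0..l e}. edge_pt G l e x \<in> T}"
      by blast
    then show "openin (top_of_set {0..l e}) {x\<in>{0..l e}. edge_pt G l e x \<in> S \<inter> T}"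
      using S T e by (metis (no_types, lifting) openin_Int)
  next
    fix \<K> e
    assume K: "\<forall>K\<in>\<K>. K \<subseteq> points G l \<and>
        (\<forall>e\<in>arcs G. openin (top_of_set {0..l e}) {x\<in>{0..l e}. edge_pt G l e x \<in> K})"
    show "\<Union>\<K> \<subseteq> points G l" using K by blast
    assume e: "e \<in> arcs G"
    have "{x\<in>{0..l e}. edge_pt G l e x \<in> \<Union>\<K>} =
        \<Union>((\<lambda>K. {x\<in>{0..l e}. edge_pt G l e x \<in> K}) ` \<K>)"
      by blast
    also have "openin (top_of_set {0..l e}) \<dots>"
      using K e by (intro openin_Union) blast
    finally show "openin (top_of_set {0..l e}) {x\<in>{0..l e}. edge_pt G l e x \<in> \<Union>\<K>}" .
  qed
  then show ?thesis
    unfolding graph_topology_def by (simp add: topology_inverse')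
qed

definition connected_graph :: "('v, 'e) pre_digraph \<Rightarrow> ('e \<Rightarrow> real) \<Rightarrow> bool" where
  "connected_graph G l \<longleftrightarrow> path_connected_space (graph_topology G l)"

text \<open>
  \<open>walk G l p q r\<close>: some concatenation of finitely many segments, each inside one edge, leads from
  \<open>p\<close> to \<open>q\<close> and has length \<open>r\<close>. The distance of two points is the length of a shortest path.
\<close>

inductive walk :: "('v, 'e) pre_digraph \<Rightarrow> ('e \<Rightarrow> real) \<Rightarrow> ('v, 'e) point \<Rightarrow> ('v, 'e) point \<Rightarrow> real \<Rightarrow> bool"
  for G l p where
  refl: "p \<in> points G l \<Longrightarrow> walk G l p p 0"
| step: "\<lbrakk>walk G l p (edge_pt G l e x) r; e \<in> arcs G; x \<in> {0..l e}; y \<in> {0..l e}\<rbrakk>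
    \<Longrightarrow> walk G l p (edge_pt G l e y) (r + \<bar>y - x\<bar>)"

definition graph_dist ::
    "('v, 'e) pre_digraph \<Rightarrow> ('e \<Rightarrow> real) \<Rightarrow> ('v, 'e) point \<Rightarrow> ('v, 'e) point \<Rightarrow> real" where
  "graph_dist G l p q = Inf {r. walk G l p q r}"


section \<open>The Laplacian with delta vertex conditions\<close>

text \<open>
  \<open>has_H2_deriv a u w\<close>: the function \<open>u\<close> on \<open>[0, a]\<close> belongs to \<open>H\<^sup>2(0, a)\<close> and \<open>w\<close> is (a
  representative of) its second weak derivative. Elements of \<open>H\<^sup>2\<close> are represented by their
  continuously differentiable representative, whose derivative is absolutely continuous, i.e. the
  indefinite integral of the second weak derivative, a function in \<open>L\<^sup>2(0, a)\<close>. Replacing \<open>w\<close> on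
  a null set makes no difference.
\<close>

definition square_integrable :: "real \<Rightarrow> (real \<Rightarrow> real) \<Rightarrow> bool" where
  "square_integrable a w \<longleftrightarrow>
     set_borel_measurable lebesgue {0..a} w \<and> set_integrable lebesgue {0..a} (\<lambda>x. (w x)\<^sup>2)"

definition has_H2_deriv :: "real \<Rightarrow> (real \<Rightarrow> real) \<Rightarrow> (real \<Rightarrow> real) \<Rightarrow> bool" where
  "has_H2_deriv a u w \<longleftrightarrow> square_integrable a w \<and>
     (\<exists>u'. (\<forall>x\<in>{0..a}. (u has_real_derivative u' x) (at x within {0..a})) \<and>
           (\<forall>x\<in>{0..a}. u' x = u' 0 + (LINT t:{0..x}|lebesgue. w t)))"

text \<open>
  A function on the metric graph is a function on its points; \<open>edge_fun G l u e\<close> is its restriction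
  to the edge \<open>e\<close>. Since \<open>u\<close> has a single value at each vertex, and functions in \<open>H\<^sup>2\<close> of an edge are
  continuous up to both ends, continuity at the vertices is built in.
\<close>

definition edge_fun :: "('v, 'e) pre_digraph \<Rightarrow> ('e \<Rightarrow> real) \<Rightarrow> (('v, 'e) point \<Rightarrow> real) \<Rightarrow> 'e \<Rightarrow> real \<Rightarrow> real"
  where "edge_fun G l u e x = u (edge_pt G l e x)"

text \<open>
  The sum over the edges at \<open>v\<close> of the derivatives pointing into \<open>v\<close>: at the end \<open>0\<close> this direction is
  the negative one. A loop at \<open>v\<close> is both in \<open>out_arcs G v\<close> and in \<open>in_arcs G v\<close>, and so is counted
  once for each of its ends.
\<close>

definition normal_deriv_sum ::
    "('v, 'e) pre_digraph \<Rightarrow> ('e \<Rightarrow> real) \<Rightarrow> (('v, 'e) point \<Rightarrow> real) \<Rightarrow> 'v \<Rightarrow> real" where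
  "normal_deriv_sum G l u v =
     (\<Sum>e\<in>out_arcs G v. - vector_derivative (edge_fun G l u e) (at 0 within {0..l e})) +
     (\<Sum>e\<in>in_arcs G v. vector_derivative (edge_fun G l u e) (at (l e) within {0..l e}))"

definition delta_domain ::
    "('v, 'e) pre_digraph \<Rightarrow> ('e \<Rightarrow> real) \<Rightarrow> ('v \<Rightarrow> real) \<Rightarrow> (('v, 'e) point \<Rightarrow> real) set" where
  "delta_domain G l \<alpha> =
     {u. (\<forall>e\<in>arcs G. \<exists>w. has_H2_deriv (l e) (edge_fun G l u e) w) \<and>
         (\<forall>v\<in>verts G. normal_deriv_sum G l u v + \<alpha> v * u (Vertex v) = 0)}"

text \<open>\<open>delta_laplacian G l \<alpha> u f\<close>: \<open>u\<close> is in the domain and the operator maps it to \<open>f\<close>, that is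
  \<open>- u'' = f\<close> in \<open>L\<^sup>2\<close> of every edge.\<close>

definition delta_laplacian :: "('v, 'e) pre_digraph \<Rightarrow> ('e \<Rightarrow> real) \<Rightarrow> ('v \<Rightarrow> real) \<Rightarrow>
    (('v, 'e) point \<Rightarrow> real) \<Rightarrow> (('v, 'e) point \<Rightarrow> real) \<Rightarrow> bool" where
  "delta_laplacian G l \<alpha> u f \<longleftrightarrow> u \<in> delta_domain G l \<alpha> \<and>
     (\<forall>e\<in>arcs G. has_H2_deriv (l e) (edge_fun G l u e) (\<lambda>x. - edge_fun G l f e x))"

text \<open>The value \<open>0\<close> outside the graph only makes the torsion function unique as a total function.\<close>

definition torsion_function ::
    "('v, 'e) pre_digraph \<Rightarrow> ('e \<Rightarrow> real) \<Rightarrow> ('v \<Rightarrow> real) \<Rightarrow> ('v, 'e) point \<Rightarrow> real" where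
  "torsion_function G l \<alpha> =
     (THE \<upsilon>. delta_laplacian G l \<alpha> \<upsilon> (\<lambda>_. 1) \<and> (\<forall>p. p \<notin> points G l \<longrightarrow> \<upsilon> p = 0))"

definition torsional_rigidity ::
    "('v, 'e) pre_digraph \<Rightarrow> ('e \<Rightarrow> real) \<Rightarrow> ('v \<Rightarrow> real) \<Rightarrow> real" where
  "torsional_rigidity G l \<alpha> =
     (\<Sum>e\<in>arcs G. LINT x:{0..l e}|lebesgue. edge_fun G l (torsion_function G l \<alpha>) e x)"


section \<open>Path graphs and identification of graphs with strengths\<close>

definition path_graph :: "(bool, unit) pre_digraph" where
  "path_graph = \<lparr>verts = UNIV, arcs = {()}, tail = (\<lambda>_. False), head = (\<lambda>_. True)\<rparr>"

definition path_length :: "real \<Rightarrow> unit \<Rightarrow> real" where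
  "path_length L = (\<lambda>_. L)"

definition path_strengths :: "real \<Rightarrow> real \<Rightarrow> bool \<Rightarrow> real" where
  "path_strengths a b = (\<lambda>v. if v then b else a)"

text \<open>
  Graphs with strengths are the same if there is an isometry between them that respects the strengths,
  where a point in the interior of an edge has strength \<open>0\<close>. The isometry need not map vertices to
  vertices: a vertex of degree two with strength \<open>0\<close> cannot be told from an interior point of an edge,
  so inserting or removing such vertices does not change the graph in this sense.
\<close>

fun strength_at :: "('v \<Rightarrow> real) \<Rightarrow> ('v, 'e) point \<Rightarrow> real" where
  "strength_at \<alpha> (Vertex v) = \<alpha> v"
| "strength_at \<alpha> (Interior e x) = 0"

definition same_graph :: "('v, 'e) pre_digraph \<Rightarrow> ('e \<Rightarrow> real) \<Rightarrow> ('v \<Rightarrow> real) \<Rightarrow>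
    ('w, 'f) pre_digraph \<Rightarrow> ('f \<Rightarrow> real) \<Rightarrow> ('w \<Rightarrow> real) \<Rightarrow> bool" where
  "same_graph G l \<alpha> H m \<beta> \<longleftrightarrow>
     (\<exists>\<phi>. bij_betw \<phi> (points G l) (points H m) \<and>
          (\<forall>p\<in>points G l. \<forall>q\<in>points G l. graph_dist H m (\<phi> p) (\<phi> q) = graph_dist G l p q) \<and>
          (\<forall>p\<in>points G l. strength_at \<beta> (\<phi> p) = strength_at \<alpha> p))"

end

theory Submission
  imports Defs "Jordan_Normal_Form.Determinant"
begin

text \<open>
  On every edge the torsion function is a parabola with leading coefficient \<open>- 1 / 2\<close>, so it is
  determined by its vertex values \<open>c\<close>, which solve a finite linear system, and \<open>T\<close> as well as the
  Dirichlet energy \<open>D\<close> are explicit in \<open>c\<close>. For every vertex \<open>r\<close> one has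
  \<open>2 (T - |G| c r) \<le> D + |G|\<^sup>3 / 3\<close>: the unit source density can be transported to \<open>r\<close> along a
  spanning tree with squared flux at most \<open>|G|\<^sup>3 / 3\<close>. Averaging over \<open>r\<close> with weights
  \<open>\<alpha> r / |\<alpha>|\<^sub>1\<close> and using \<open>\<Sum> \<alpha> c = |G|\<close>, \<open>T = D + \<Sum> \<alpha> c\<^sup>2\<close> and Cauchy-Schwarz gives the bound.
  Equality forbids branchings and cycles: the graph is a path that starts at \<open>r\<close>, and \<open>c\<close> has its
  strict minimum at every \<open>r\<close> with \<open>\<alpha> r > 0\<close>, so there is only one such vertex. Conversely, an
  isometry onto the interval pulls the torsion function of the interval back to a test function for
  the variational characterization of \<open>T\<close>, which yields the reverse inequality.
\<close>

section \<open>Solvability of square linear systems indexed by a finite set\<close>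

lemma square_linear_system_solvable:
  fixes M :: "'a \<Rightarrow> 'a \<Rightarrow> real"
  assumes fin: "finite V"
    and ker: "\<And>x. (\<And>i. i \<in> V \<Longrightarrow> (\<Sum>j\<in>V. M i j * x j) = 0) \<Longrightarrow> (\<And>i. i \<in> V \<Longrightarrow> x i = 0)"
  obtains x where "\<And>i. i \<in> V \<Longrightarrow> (\<Sum>j\<in>V. M i j * x j) = b i"
proof -
  define n where "n = card V"
  obtain h where h: "bij_betw h {0..<n} V"
    using ex_bij_betw_nat_finite[OF fin] n_def by blast
  define k where "k = the_inv_into {0..<n} h"
  have hk: "h (k i) = i" "k i < n" if "i \<in> V" for i
    using h that f_the_inv_into_f_bij_betw[OF h] the_inv_into_into[of h "{0..<n}" i "{0..<n}"]
    by (auto simp: k_def bij_betw_def)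
  have kh: "k (h i) = i" "h i \<in> V" if "i < n" for i
    using h that by (auto simp: k_def bij_betw_def the_inv_into_f_f)
  have reindex: "(\<Sum>j\<in>V. f j) = (\<Sum>j\<in>{0..<n}. f (h j))" for f :: "'a \<Rightarrow> real"
    using sum.reindex_bij_betw[OF h, of f] by simp
  define B where "B = mat n n (\<lambda>(i, j). M (h i) (h j))"
  have B: "B \<in> carrier_mat n n" by (simp add: B_def)
  have mult: "vec_index (B *\<^sub>v v) i = (\<Sum>j\<in>V. M (h i) j * vec_index v (k j))" if "v \<in> carrier_vec n" "i < n" for v i
    using that by (simp add: B_def scalar_prod_def reindex kh)
  \<comment> \<open>A singular matrix would have a nonzero kernel vector, which transported to
    \<open>V\<close> along \<open>k\<close> contradicts \<open>ker\<close>. The inverse matrix then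
    produces the solution.\<close>
  have "det B \<noteq> 0"
  proof
    assume "det B = 0"
    then obtain v where v: "v \<in> carrier_vec n" "v \<noteq> 0\<^sub>v n" "B *\<^sub>v v = 0\<^sub>v n"
      using det_0_iff_vec_prod_zero_field[OF B] by blast
    have "(\<Sum>j\<in>V. M i j * vec_index v (k j)) = 0" if "i \<in> V" for i
      using mult[OF v(1) hk(2)[OF that]] v(3) hk[OF that] by simp
    then have z: "vec_index v (k i) = 0" if "i \<in> V" for i
      using ker[of "\<lambda>i. vec_index v (k i)"] that by blast
    have "v = 0\<^sub>v n"
      using v(1) z kh by (intro eq_vecI) (auto, metis)
    with v(2) show False by simp
  qed
  then obtain C where C: "C \<in> carrier_mat n n" "B * C = 1\<^sub>m n"
    using det_non_zero_imp_unit[OF B] unfolding Units_def ring_mat_def by auto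
  define w where "w = C *\<^sub>v vec n (\<lambda>i. b (h i))"
  have w: "w \<in> carrier_vec n" using C by (simp add: w_def)
  have "B *\<^sub>v w = vec n (\<lambda>i. b (h i))"
    unfolding w_def using C B
    by (metis assoc_mult_mat_vec one_mult_mat_vec vec_carrier)
  then have "(\<Sum>j\<in>V. M i j * vec_index w (k j)) = b i" if "i \<in> V" for i
    using mult[OF w hk(2)[OF that]] hk[OF that] by simp
  then show thesis by (rule that)
qed

section \<open>The torsion function and its vertex values\<close>

definition torsion_quad :: "real \<Rightarrow> real \<Rightarrow> real \<Rightarrow> real \<Rightarrow> real" where
  "torsion_quad a b L x = a + ((b - a) / L + L / 2) * x - x\<^sup>2 / 2"

lemma torsion_quad_0 [simp]: "torsion_quad a b L 0 = a"
  by (simp add: torsion_quad_def)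

lemma torsion_quad_end [simp]: "L \<noteq> 0 \<Longrightarrow> torsion_quad a b L L = b"
  by (simp add: torsion_quad_def field_simps power2_eq_square)

lemma torsion_quad_deriv:
  "(torsion_quad a b L has_real_derivative (b - a) / L + L / 2 - x) (at x within S)"
  unfolding torsion_quad_def by (auto intro!: derivative_eq_intros)

lemma lebesgue_integral_const_Icc: "0 \<le> x \<Longrightarrow> (LINT t:{0..x}|lebesgue. (c::real)) = x * c"
  by (simp add: set_lebesgue_integral_def)

text \<open>Integrating the constant \<open>- 1\<close> forces \<open>u' x = u' 0 - x\<close>, so
  the weak equation has only classical solutions; the two end values fix the two constants of
  integration.\<close>

lemma has_H2_deriv_minus_one_iff:
  assumes "0 < L"
  shows "has_H2_deriv L u (\<lambda>_. - 1) \<longleftrightarrow> (\<forall>x\<in>{0..L}. u x = torsion_quad (u 0) (u L) L x)"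
proof
  assume "has_H2_deriv L u (\<lambda>_. - 1)"
  then obtain u' where
      d: "\<And>x. x \<in> {0..L} \<Longrightarrow> (u has_real_derivative u' x) (at x within {0..L})"
    and i: "\<And>x. x \<in> {0..L} \<Longrightarrow> u' x = u' 0 + (LINT t:{0..x}|lebesgue. - 1)"
    unfolding has_H2_deriv_def by blast
  have u': "u' x = u' 0 - x" if "x \<in> {0..L}" for x
    using i[OF that] that by (simp only: lebesgue_integral_const_Icc atLeastAtMost_iff)
  have "((\<lambda>x. u x - (u' 0 * x - x\<^sup>2 / 2)) has_real_derivative 0) (at x within {0..L})"
    if "x \<in> {0..L}" for x
    using u'[OF that] by (auto intro!: derivative_eq_intros d that)
  then obtain c where c: "\<And>x. x \<in> {0..L} \<Longrightarrow> u x - (u' 0 * x - x\<^sup>2 / 2) = c"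
    using has_field_derivative_zero_constant[of "{0..L}" "\<lambda>x. u x - (u' 0 * x - x\<^sup>2 / 2)"] by auto
  have u: "u x = c + u' 0 * x - x\<^sup>2 / 2" if "x \<in> {0..L}" for x
    using c[OF that] by simp
  show "\<forall>x\<in>{0..L}. u x = torsion_quad (u 0) (u L) L x"
    using u u[of 0] u[of L] assms
    by (simp add: torsion_quad_def field_simps power2_eq_square)
next
  assume u: "\<forall>x\<in>{0..L}. u x = torsion_quad (u 0) (u L) L x"
  then have eq: "torsion_quad (u 0) (u L) L y = u y" if "y \<in> {0..L}" for y
    using that by metis
  let ?u' = "\<lambda>x. (u L - u 0) / L + L / 2 - x"
  have "(u has_real_derivative ?u' x) (at x within {0..L})" if "x \<in> {0..L}" for x
    by (rule has_field_derivative_transform_within[OF torsion_quad_deriv, where d = 1])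
      (use that eq in auto)
  moreover have "?u' x = ?u' 0 + (LINT t:{0..x}|lebesgue. - 1)" if "x \<in> {0..L}" for x
    using that by (simp only: lebesgue_integral_const_Icc atLeastAtMost_iff)
  moreover have "square_integrable L (\<lambda>_. - 1)"
    unfolding square_integrable_def set_borel_measurable_def set_integrable_def
    by (auto intro!: borel_measurable_indicator integrable_real_indicator simp: emeasure_lborel_Icc_eq)
  ultimately show "has_H2_deriv L u (\<lambda>_. - 1)"
    unfolding has_H2_deriv_def by blast
qed

lemma vector_derivative_torsion_quad:
  assumes "0 < L" "x \<in> {0..L}" "\<And>y. y \<in> {0..L} \<Longrightarrow> u y = torsion_quad a b L y"
  shows "vector_derivative u (at x within {0..L}) = (b - a) / L + L / 2 - x"
proof -
  have "(u has_real_derivative (b - a) / L + L / 2 - x) (at x within {0..L})"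
    using assms by (intro has_field_derivative_transform_within[OF torsion_quad_deriv, where d = 1]) auto
  then show ?thesis
    using assms by (intro vector_derivative_within_closed_interval)
      (auto simp: has_real_derivative_iff_has_vector_derivative)
qed

text \<open>The explicit primitive gives the trapezoidal value plus a curvature term depending on
  \<open>L\<close> alone, so integrals of torsion functions become affine in the vertex
  values.\<close>

lemma integral_torsion_quad:
  assumes "0 < L"
  shows "(LINT x:{0..L}|lebesgue. torsion_quad a b L x) = L * (a + b) / 2 + L ^ 3 / 12"
proof -
  let ?F = "\<lambda>x. a * x + ((b - a) / L + L / 2) * x\<^sup>2 / 2 - x ^ 3 / 6"
  have cont: "continuous_on {0..L} (torsion_quad a b L)"
    unfolding torsion_quad_def divide_inverse by (intro continuous_intros)
  have "(torsion_quad a b L has_integral ?F L - ?F 0) {0..L}"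
    using assms
    by (intro fundamental_theorem_of_calculus)
      (auto intro!: derivative_eq_intros simp: torsion_quad_def field_simps power2_eq_square
        simp flip: has_real_derivative_iff_has_vector_derivative)
  moreover have "set_integrable lebesgue {0..L} (torsion_quad a b L)"
    using borel_integrable_atLeastAtMost'[OF cont] cont
    by (metis absolutely_integrable_continuous_real)
  ultimately have "(LINT x:{0..L}|lebesgue. torsion_quad a b L x) = ?F L - ?F 0"
    by (simp add: set_lebesgue_integral_eq_integral integral_unique)
  also have "\<dots> = L * (a + b) / 2 + L ^ 3 / 12"
    using assms by (simp add: field_simps power2_eq_square power3_eq_cube)
  finally show ?thesis .
qed

section \<open>The discrete problem for the vertex values\<close>

context metric_graph
begin

lemma length_nonzero: "e \<in> arcs G \<Longrightarrow> l e \<noteq> 0"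
  using length_pos by fastforce

text \<open>Every arc has exactly one tail, so the arcs can be grouped by tail. Together with
  \<open>sum_in_arcs\<close> this carries out summation by parts on the graph.\<close>

lemma sum_out_arcs:
  fixes h :: "'e \<Rightarrow> real"
  shows "(\<Sum>v\<in>verts G. \<phi> v * (\<Sum>e\<in>out_arcs G v. h e)) = (\<Sum>e\<in>arcs G. \<phi> (tail G e) * h e)"
proof -
  have "(\<Sum>e\<in>arcs G. \<phi> (tail G e) * h e) =
      (\<Sum>v\<in>verts G. \<Sum>e\<in>{e\<in>arcs G. tail G e = v}. \<phi> (tail G e) * h e)"
    by (rule sum.group[symmetric]) auto
  also have "\<dots> = (\<Sum>v\<in>verts G. \<phi> v * (\<Sum>e\<in>out_arcs G v. h e))"
    by (simp add: out_arcs_def sum_distrib_left)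
  finally show ?thesis by simp
qed

lemma sum_in_arcs:
  fixes h :: "'e \<Rightarrow> real"
  shows "(\<Sum>v\<in>verts G. \<phi> v * (\<Sum>e\<in>in_arcs G v. h e)) = (\<Sum>e\<in>arcs G. \<phi> (head G e) * h e)"
proof -
  have "(\<Sum>e\<in>arcs G. \<phi> (head G e) * h e) =
      (\<Sum>v\<in>verts G. \<Sum>e\<in>{e\<in>arcs G. head G e = v}. \<phi> (head G e) * h e)"
    by (rule sum.group[symmetric]) auto
  also have "\<dots> = (\<Sum>v\<in>verts G. \<phi> v * (\<Sum>e\<in>in_arcs G v. h e))"
    by (simp add: in_arcs_def sum_distrib_left)
  finally show ?thesis by simp
qed

definition edge_diff :: "('v \<Rightarrow> real) \<Rightarrow> 'e \<Rightarrow> real" where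
  "edge_diff c e = c (head G e) - c (tail G e)"

text \<open>The weighted graph Laplacian with conductances \<open>1 / l e\<close>, plus the
  potential \<open>\<alpha>\<close>.\<close>

definition vertex_form :: "('v \<Rightarrow> real) \<Rightarrow> ('v \<Rightarrow> real) \<Rightarrow> 'v \<Rightarrow> real" where
  "vertex_form \<alpha> c v =
     (\<Sum>e\<in>out_arcs G v. - (edge_diff c e / l e)) + (\<Sum>e\<in>in_arcs G v. edge_diff c e / l e) + \<alpha> v * c v"

text \<open>Each edge delivers half of its unit source to each of its ends; a loop delivers both
  halves to the same vertex.\<close>

definition vertex_load :: "'v \<Rightarrow> real" where
  "vertex_load v = (\<Sum>e\<in>out_arcs G v. l e / 2) + (\<Sum>e\<in>in_arcs G v. l e / 2)"

definition torsion_values :: "('v \<Rightarrow> real) \<Rightarrow> ('v \<Rightarrow> real) \<Rightarrow> bool" where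
  "torsion_values \<alpha> c \<longleftrightarrow> (\<forall>v\<in>verts G. vertex_form \<alpha> c v = vertex_load v)"

text \<open>A discrete Green formula: summation by parts makes the form symmetric in
  \<open>c\<close> and \<open>\<phi>\<close>.\<close>

lemma sum_vertex_form:
  "(\<Sum>v\<in>verts G. \<phi> v * vertex_form \<alpha> c v) =
     (\<Sum>e\<in>arcs G. edge_diff c e * edge_diff \<phi> e / l e) + (\<Sum>v\<in>verts G. \<alpha> v * c v * \<phi> v)"
proof -
  have "(\<Sum>v\<in>verts G. \<phi> v * vertex_form \<alpha> c v) =
      (\<Sum>e\<in>arcs G. \<phi> (tail G e) * - (edge_diff c e / l e)) +
      (\<Sum>e\<in>arcs G. \<phi> (head G e) * (edge_diff c e / l e)) + (\<Sum>v\<in>verts G. \<alpha> v * c v * \<phi> v)"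
    unfolding vertex_form_def distrib_left sum.distrib sum_out_arcs sum_in_arcs
    by (simp add: mult_ac)
  also have "(\<Sum>e\<in>arcs G. \<phi> (tail G e) * - (edge_diff c e / l e)) +
      (\<Sum>e\<in>arcs G. \<phi> (head G e) * (edge_diff c e / l e)) =
      (\<Sum>e\<in>arcs G. edge_diff c e * edge_diff \<phi> e / l e)"
    unfolding sum.distrib[symmetric]
    by (rule sum.cong) (simp_all add: edge_diff_def[of \<phi>] field_simps add_divide_distrib diff_divide_distrib)
  finally show ?thesis .
qed

lemma sum_vertex_load:
  "(\<Sum>v\<in>verts G. \<phi> v * vertex_load v) = (\<Sum>e\<in>arcs G. l e * (\<phi> (tail G e) + \<phi> (head G e)) / 2)"
proof -
  have "(\<Sum>v\<in>verts G. \<phi> v * vertex_load v) =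
      (\<Sum>e\<in>arcs G. \<phi> (tail G e) * (l e / 2)) + (\<Sum>e\<in>arcs G. \<phi> (head G e) * (l e / 2))"
    unfolding vertex_load_def distrib_left sum.distrib sum_out_arcs sum_in_arcs ..
  then show ?thesis
    unfolding sum.distrib[symmetric] by (simp add: field_simps)
qed

text \<open>The weak formulation with test function \<open>\<phi>\<close>. The choices
  \<open>1\<close>, \<open>c\<close> and an arbitrary competitor give all energy relations
  below.\<close>

lemma torsion_values_weak:
  assumes "torsion_values \<alpha> c"
  shows "(\<Sum>e\<in>arcs G. edge_diff c e * edge_diff \<phi> e / l e) + (\<Sum>v\<in>verts G. \<alpha> v * c v * \<phi> v) =
    (\<Sum>e\<in>arcs G. l e * (\<phi> (tail G e) + \<phi> (head G e)) / 2)"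
  unfolding sum_vertex_form[symmetric] sum_vertex_load[symmetric]
  using assms by (simp add: torsion_values_def)

text \<open>Adjacency regardless of orientation. It is relative to an edge set because reachability
  is later studied after edges have been removed.\<close>

definition adj :: "'e set \<Rightarrow> ('v \<times> 'v) set" where
  "adj F = (\<Union>e\<in>F. {(tail G e, head G e), (head G e, tail G e)})"

text \<open>Testing the homogeneous system with its own solution makes a sum of nonnegative terms
  vanish. Hence \<open>c\<close> is constant along edges and zero at \<open>r\<close>, and
  reachability carries the zero to every vertex.\<close>

lemma vertex_form_trivial_kernel:
  assumes pos: "\<And>v. v \<in> verts G \<Longrightarrow> 0 \<le> \<alpha> v"
    and r: "r \<in> verts G" "\<alpha> r \<noteq> 0"
    and conn: "\<And>v. v \<in> verts G \<Longrightarrow> (r, v) \<in> (adj (arcs G))\<^sup>*"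
    and ker: "\<And>v. v \<in> verts G \<Longrightarrow> vertex_form \<alpha> c v = 0"
    and v: "v \<in> verts G"
  shows "c v = 0"
proof -
  have "(\<Sum>e\<in>arcs G. edge_diff c e * edge_diff c e / l e) + (\<Sum>v\<in>verts G. \<alpha> v * c v * c v) = 0"
    unfolding sum_vertex_form[symmetric] using ker by simp
  moreover have a: "0 \<le> edge_diff c e * edge_diff c e / l e" if "e \<in> arcs G" for e
    using length_pos[OF that] by simp
  moreover have b: "0 \<le> \<alpha> v * c v * c v" if "v \<in> verts G" for v
    using pos[OF that] by (simp add: mult.assoc)
  ultimately have "(\<Sum>e\<in>arcs G. edge_diff c e * edge_diff c e / l e) = 0"
      "(\<Sum>v\<in>verts G. \<alpha> v * c v * c v) = 0"
    using sum_nonneg[of "arcs G" "\<lambda>e. edge_diff c e * edge_diff c e / l e"]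
      sum_nonneg[of "verts G" "\<lambda>v. \<alpha> v * c v * c v"] by fastforce+
  then have "\<forall>e\<in>arcs G. edge_diff c e * edge_diff c e / l e = 0" "\<forall>v\<in>verts G. \<alpha> v * c v * c v = 0"
    using sum_nonneg_eq_0_iff[OF finite_arcs, of "\<lambda>e. edge_diff c e * edge_diff c e / l e"]
      sum_nonneg_eq_0_iff[OF finite_verts, of "\<lambda>v. \<alpha> v * c v * c v"] a b by blast+
  then have d: "c (head G e) = c (tail G e)" if "e \<in> arcs G" for e
    using length_nonzero that by (auto simp: edge_diff_def)
  have cr: "c r = 0"
    using r \<open>\<forall>v\<in>verts G. \<alpha> v * c v * c v = 0\<close> by auto
  have "c v = 0" if "(r, v) \<in> (adj (arcs G))\<^sup>*" for v
    using that by induction (auto simp: cr adj_def d)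
  then show ?thesis using conn[OF v] .
qed

lemma torsion_values_unique:
  assumes pos: "\<And>v. v \<in> verts G \<Longrightarrow> 0 \<le> \<alpha> v"
    and r: "r \<in> verts G" "\<alpha> r \<noteq> 0"
    and conn: "\<And>v. v \<in> verts G \<Longrightarrow> (r, v) \<in> (adj (arcs G))\<^sup>*"
    and c: "torsion_values \<alpha> c" and c': "torsion_values \<alpha> c'"
    and v: "v \<in> verts G"
  shows "c v = c' v"
proof -
  have lin: "vertex_form \<alpha> (\<lambda>v. c v - c' v) w = vertex_form \<alpha> c w - vertex_form \<alpha> c' w" for w
  proof -
    have "edge_diff (\<lambda>v. c v - c' v) e = edge_diff c e - edge_diff c' e" for e
      by (simp add: edge_diff_def)
    then show ?thesis
      by (simp add: vertex_form_def diff_divide_distrib sum_subtractf sum_negf right_diff_distrib)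
  qed
  have "c v - c' v = 0"
    using c c' by (intro vertex_form_trivial_kernel[where \<alpha> = \<alpha>, OF pos r conn _ v, of "\<lambda>v. c v - c' v"])
      (auto simp: lin torsion_values_def)
  then show ?thesis by simp
qed

lemma torsion_values_exist:
  assumes pos: "\<And>v. v \<in> verts G \<Longrightarrow> 0 \<le> \<alpha> v"
    and r: "r \<in> verts G" "\<alpha> r \<noteq> 0"
    and conn: "\<And>v. v \<in> verts G \<Longrightarrow> (r, v) \<in> (adj (arcs G))\<^sup>*"
  obtains c where "torsion_values \<alpha> c"
proof -
  define unit where "unit w = (\<lambda>v. of_bool (v = w) :: real)" for w :: 'v
  \<comment> \<open>The columns of \<open>M\<close> are the images of the indicator vectors, so the
    matrix acts as \<open>vertex_form\<close> and inherits its trivial kernel.\<close>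
  define M where "M v w = vertex_form \<alpha> (unit w) v" for v w
  have combination: "(\<Sum>w\<in>verts G. unit w x * c w) = c x" if "x \<in> verts G" for c x
    using that by (simp add: unit_def if_distrib[of "\<lambda>b. b * _"] of_bool_def sum.delta cong: if_cong)
  have diff: "(\<Sum>w\<in>verts G. edge_diff (unit w) e * c w) = edge_diff c e" if "e \<in> arcs G" for c e
    using that by (simp add: edge_diff_def left_diff_distrib sum_subtractf combination)
  have diffl: "(\<Sum>w\<in>verts G. edge_diff (unit w) e / l e * c w) = edge_diff c e / l e"
    if "e \<in> arcs G" for c e
    using diff[OF that, of c] by (simp add: sum_divide_distrib[symmetric] times_divide_eq_left)
  have M: "(\<Sum>w\<in>verts G. M v w * c w) = vertex_form \<alpha> c v" if v: "v \<in> verts G" for v c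
  proof -
    have "(\<Sum>w\<in>verts G. M v w * c w) =
        (\<Sum>w\<in>verts G. \<Sum>e\<in>out_arcs G v. - (edge_diff (unit w) e / l e * c w)) +
        (\<Sum>w\<in>verts G. \<Sum>e\<in>in_arcs G v. edge_diff (unit w) e / l e * c w) +
        \<alpha> v * (\<Sum>w\<in>verts G. unit w v * c w)"
      by (simp add: M_def vertex_form_def ring_distribs sum.distrib sum_distrib_left
          sum_distrib_right mult_ac)
    also have "(\<Sum>w\<in>verts G. \<Sum>e\<in>out_arcs G v. - (edge_diff (unit w) e / l e * c w)) =
        (\<Sum>e\<in>out_arcs G v. - (edge_diff c e / l e))"
      by (subst sum.swap) (auto simp: sum_negf out_arcs_def diffl simp del: times_divide_eq_left intro!: sum.cong)
    also have "(\<Sum>w\<in>verts G. \<Sum>e\<in>in_arcs G v. edge_diff (unit w) e / l e * c w) =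
        (\<Sum>e\<in>in_arcs G v. edge_diff c e / l e)"
      by (subst sum.swap) (auto simp: in_arcs_def diffl simp del: times_divide_eq_left intro!: sum.cong)
    finally show ?thesis by (simp add: vertex_form_def combination v)
  qed
  have ker: "x v = 0" if x: "\<And>v. v \<in> verts G \<Longrightarrow> (\<Sum>w\<in>verts G. M v w * x w) = 0" and v: "v \<in> verts G" for x v
    by (rule vertex_form_trivial_kernel[where \<alpha> = \<alpha>, OF pos r conn _ v]) (simp_all add: M[symmetric] x)
  obtain c where "\<And>v. v \<in> verts G \<Longrightarrow> (\<Sum>w\<in>verts G. M v w * c w) = vertex_load v"
  proof (rule square_linear_system_solvable[of "verts G" M vertex_load])
    show "x i = 0" if "\<And>i. i \<in> verts G \<Longrightarrow> (\<Sum>j\<in>verts G. M i j * x j) = 0" "i \<in> verts G" for x i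
      using that by (rule ker)
  qed (rule finite_verts, rule that)
  then show thesis by (intro that[of c]) (simp add: torsion_values_def M)
qed

section \<open>From vertex values to functions on the graph\<close>

lemma edge_pt_0 [simp]: "edge_pt G l e 0 = Vertex (tail G e)"
  by (simp add: edge_pt_def)

lemma edge_pt_end [simp]: "e \<in> arcs G \<Longrightarrow> edge_pt G l e (l e) = Vertex (head G e)"
  using length_nonzero by (simp add: edge_pt_def)

lemma edge_pt_interior: "0 < x \<Longrightarrow> x < l e \<Longrightarrow> edge_pt G l e x = Interior e x"
  by (simp add: edge_pt_def)

lemma edge_pt_in_points: "e \<in> arcs G \<Longrightarrow> x \<in> {0..l e} \<Longrightarrow> edge_pt G l e x \<in> points G l"
  by (auto simp: edge_pt_def points_def)

definition edgewise_quad :: "(('v, 'e) point \<Rightarrow> real) \<Rightarrow> bool" where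
  "edgewise_quad u \<longleftrightarrow> (\<forall>e\<in>arcs G. \<forall>x\<in>{0..l e}. u (edge_pt G l e x) =
     torsion_quad (u (Vertex (tail G e))) (u (Vertex (head G e))) (l e) x)"

text \<open>With \<open>d\<close> the difference of the end values, the parabola has slope
  \<open>d / l e + l e / 2\<close> at \<open>0\<close> and \<open>d / l e - l e / 2\<close> at
  \<open>l e\<close>. In the direction into the vertex both half lengths get a minus sign and add up
  to \<open>vertex_load\<close>.\<close>

lemma normal_deriv_sum_quad:
  assumes "edgewise_quad u"
  shows "normal_deriv_sum G l u v + \<alpha> v * u (Vertex v) =
    vertex_form \<alpha> (\<lambda>v. u (Vertex v)) v - vertex_load v"
proof -
  let ?d = "edge_diff (\<lambda>v. u (Vertex v))"
  have d: "vector_derivative (edge_fun G l u e) (at x within {0..l e}) = ?d e / l e + l e / 2 - x"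
    if "e \<in> arcs G" "x \<in> {0..l e}" for e x
    unfolding edge_diff_def
    using assms that by (intro vector_derivative_torsion_quad length_pos)
      (auto simp: edgewise_quad_def edge_fun_def)
  have "(\<Sum>e\<in>out_arcs G v. - vector_derivative (edge_fun G l u e) (at 0 within {0..l e})) =
      (\<Sum>e\<in>out_arcs G v. - (?d e / l e)) - (\<Sum>e\<in>out_arcs G v. l e / 2)"
    unfolding sum_subtractf[symmetric]
    by (rule sum.cong) (auto simp: d less_imp_le length_pos out_arcs_def)
  moreover have "(\<Sum>e\<in>in_arcs G v. vector_derivative (edge_fun G l u e) (at (l e) within {0..l e})) =
      (\<Sum>e\<in>in_arcs G v. ?d e / l e) - (\<Sum>e\<in>in_arcs G v. l e / 2)"
    unfolding sum_subtractf[symmetric]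
    by (rule sum.cong) (auto simp: d less_imp_le length_pos in_arcs_def)
  ultimately show ?thesis
    by (simp add: normal_deriv_sum_def vertex_form_def vertex_load_def)
qed

text \<open>The reduction to a finite linear system: the equation on the edges fixes the parabolas,
  the vertex conditions fix their end values.\<close>

lemma delta_laplacian_one_iff:
  "delta_laplacian G l \<alpha> u (\<lambda>_. 1) \<longleftrightarrow>
     edgewise_quad u \<and> torsion_values \<alpha> (\<lambda>v. u (Vertex v))"
proof -
  have "has_H2_deriv (l e) (edge_fun G l u e) (\<lambda>x. - edge_fun G l (\<lambda>_. 1) e x) \<longleftrightarrow>
      (\<forall>x\<in>{0..l e}. u (edge_pt G l e x) =
        torsion_quad (u (Vertex (tail G e))) (u (Vertex (head G e))) (l e) x)"
    if "e \<in> arcs G" for e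
    using has_H2_deriv_minus_one_iff[OF length_pos[OF that], of "edge_fun G l u e"] that
    by (simp add: edge_fun_def)
  then have "(\<forall>e\<in>arcs G. has_H2_deriv (l e) (edge_fun G l u e) (\<lambda>x. - edge_fun G l (\<lambda>_. 1) e x)) \<longleftrightarrow>
      edgewise_quad u"
    unfolding edgewise_quad_def by (rule ball_cong[OF HOL.refl])
  moreover have "(\<forall>v\<in>verts G. normal_deriv_sum G l u v + \<alpha> v * u (Vertex v) = 0) \<longleftrightarrow>
      torsion_values \<alpha> (\<lambda>v. u (Vertex v))" if "edgewise_quad u"
    using normal_deriv_sum_quad[OF that] by (simp add: torsion_values_def)
  ultimately show ?thesis
    unfolding delta_laplacian_def delta_domain_def by blast
qed

text \<open>The zero values off the graph match the normalization in
  \<open>torsion_function\<close>.\<close>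

fun quad_extension :: "('v \<Rightarrow> real) \<Rightarrow> ('v, 'e) point \<Rightarrow> real" where
  "quad_extension c (Vertex v) = (if v \<in> verts G then c v else 0)"
| "quad_extension c (Interior e x) =
     (if e \<in> arcs G \<and> 0 < x \<and> x < l e then torsion_quad (c (tail G e)) (c (head G e)) (l e) x else 0)"

lemma quad_extension_edge:
  assumes "e \<in> arcs G" "x \<in> {0..l e}"
  shows "quad_extension c (edge_pt G l e x) = torsion_quad (c (tail G e)) (c (head G e)) (l e) x"
  using assms length_nonzero by (auto simp: edge_pt_def)

text \<open>Uniqueness of the vertex values identifies the definite description with
  \<open>quad_extension c\<close>, which is then integrated edge by edge.\<close>

lemma torsional_rigidity_eq:
  assumes pos: "\<And>v. v \<in> verts G \<Longrightarrow> 0 \<le> \<alpha> v"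
    and r: "r \<in> verts G" "\<alpha> r \<noteq> 0"
    and conn: "\<And>v. v \<in> verts G \<Longrightarrow> (r, v) \<in> (adj (arcs G))\<^sup>*"
    and c: "torsion_values \<alpha> c"
  shows "torsional_rigidity G l \<alpha> =
    (\<Sum>e\<in>arcs G. l e * (c (tail G e) + c (head G e)) / 2 + l e ^ 3 / 12)"
proof -
  let ?u = "quad_extension c"
  \<comment> \<open>Truncating \<open>c\<close> to zero off \<open>verts G\<close> is harmless,
    because the ends of arcs are vertices.\<close>
  have cong: "vertex_form \<alpha> (\<lambda>v. ?u (Vertex v)) v = vertex_form \<alpha> c v" if "v \<in> verts G" for v
    using that by (auto simp: vertex_form_def edge_diff_def in_arcs_def out_arcs_def intro!: arg_cong2[where f = "(+)"] sum.cong)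
  have "torsion_function G l \<alpha> = ?u"
    unfolding torsion_function_def
  proof (rule the_equality, intro conjI allI impI)
    show "delta_laplacian G l \<alpha> ?u (\<lambda>_. 1)"
      unfolding delta_laplacian_one_iff edgewise_quad_def
      using c cong by (simp add: quad_extension_edge torsion_values_def)
    show "?u p = 0" if "p \<notin> points G l" for p
      using that by (cases p) (auto simp: points_def)
  next
    fix u assume "delta_laplacian G l \<alpha> u (\<lambda>_. 1) \<and> (\<forall>p. p \<notin> points G l \<longrightarrow> u p = 0)"
    then have q: "edgewise_quad u" and t: "torsion_values \<alpha> (\<lambda>v. u (Vertex v))"
      and z: "\<And>p. p \<notin> points G l \<Longrightarrow> u p = 0"
      unfolding delta_laplacian_one_iff by auto
    have v: "u (Vertex v) = c v" if "v \<in> verts G" for v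
      using torsion_values_unique[where \<alpha> = \<alpha>, OF pos r conn t c that] by simp
    show "u = ?u"
    proof
      fix p
      show "u p = ?u p"
      proof (cases p)
        case (Vertex v)
        then show ?thesis using v z[of p] by (auto simp: points_def)
      next
        case (Interior e x)
        show ?thesis
        proof (cases "e \<in> arcs G \<and> 0 < x \<and> x < l e")
          case True
          then show ?thesis
            using q[unfolded edgewise_quad_def, THEN bspec, THEN bspec, of e x] Interior
            by (simp add: v edge_pt_interior)
        next
          case False
          then show ?thesis using Interior z[of p] by (auto simp: points_def)
        qed
      qed
    qed
  qed
  moreover have "(LINT x:{0..l e}|lebesgue. edge_fun G l ?u e x) =
      l e * (c (tail G e) + c (head G e)) / 2 + l e ^ 3 / 12" if "e \<in> arcs G" for e
  proof -
    have "(LINT x:{0..l e}|lebesgue. edge_fun G l ?u e x) =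
        (LINT x:{0..l e}|lebesgue. torsion_quad (c (tail G e)) (c (head G e)) (l e) x)"
      using that by (intro set_lebesgue_integral_cong) (auto simp: edge_fun_def quad_extension_edge)
    then show ?thesis
      using integral_torsion_quad[OF length_pos[OF that]] by simp
  qed
  ultimately show ?thesis
    by (simp add: torsional_rigidity_def)
qed

end

section \<open>The upper bound\<close>

context metric_graph
begin

text \<open>
  \<open>edge_mass c F\<close> and \<open>dirichlet c F\<close> are the integrals of \<open>u\<close> and of \<open>(u')\<^sup>2\<close> over the edges in \<open>F\<close>,
  where \<open>u\<close> is the edgewise parabola with \<open>u'' = - 1\<close> and vertex values \<open>c\<close>.
\<close>

definition dirichlet :: "('v \<Rightarrow> real) \<Rightarrow> 'e set \<Rightarrow> real" where
  "dirichlet c F = (\<Sum>e\<in>F. (edge_diff c e)\<^sup>2 / l e + l e ^ 3 / 12)"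

definition edge_mass :: "('v \<Rightarrow> real) \<Rightarrow> 'e set \<Rightarrow> real" where
  "edge_mass c F = (\<Sum>e\<in>F. l e * (c (tail G e) + c (head G e)) / 2 + l e ^ 3 / 12)"

text \<open>On a path of length \<open>L\<close> starting at \<open>r\<close> this is the integral
  of \<open>(u' - (L - x))\<^sup>2\<close>, with \<open>x\<close> the distance from
  \<open>r\<close>. In general it is the slack in the estimate at \<open>r\<close>.\<close>

definition deficit :: "('v \<Rightarrow> real) \<Rightarrow> 'e set \<Rightarrow> 'v \<Rightarrow> real" where
  "deficit c F r = dirichlet c F + (sum l F) ^ 3 / 3 - 2 * (edge_mass c F - c r * sum l F)"

text \<open>A path that grows at its front: \<open>w\<close> is the old start, \<open>r\<close> the
  new one, and the last premise keeps the new vertex off the old edges.\<close>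

inductive chain :: "'v \<Rightarrow> 'e set \<Rightarrow> bool" where
  nil: "r \<in> verts G \<Longrightarrow> chain r {}"
| step: "\<lbrakk>chain w F; e \<in> arcs G; e \<notin> F; (tail G e, head G e) \<in> {(r, w), (w, r)}; r \<noteq> w;
    \<And>f. f \<in> F \<Longrightarrow> tail G f \<noteq> r \<and> head G f \<noteq> r\<rbrakk> \<Longrightarrow> chain r (insert e F)"

text \<open>The source on \<open>F'\<close> flows through \<open>e\<close> to \<open>r\<close>; the
  square is the deviation of the derivative from this flux, integrated along \<open>e\<close>. The
  last term is \<open>((a + b) ^ 3 - a ^ 3 - b ^ 3) / 3\<close> with \<open>a = sum l F\<close> and
  \<open>b = sum l F' + l e\<close>.\<close>

lemma deficit_split:
  assumes fin: "finite F" "finite F'" and disj: "F \<inter> F' = {}" "e \<notin> F" "e \<notin> F'" and e: "e \<in> arcs G"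
    and ends: "(tail G e, head G e) \<in> {(r, w), (w, r)}"
  shows "deficit c (insert e (F \<union> F')) r = deficit c F r + deficit c F' w
    + (c w - c r - l e * (sum l F' + l e / 2))\<^sup>2 / l e + sum l F * (sum l F' + l e) * (sum l F + sum l F' + l e)"
proof -
  have sums: "sum h (insert e (F \<union> F')) = h e + sum h F + sum h F'" for h :: "'e \<Rightarrow> real"
    using fin disj by (simp add: sum.union_disjoint)
  have sq: "(d - x * k)\<^sup>2 / x = d\<^sup>2 / x - 2 * d * k + x * k\<^sup>2" if "x \<noteq> 0" for d x k :: real
    using that by (simp add: field_simps power2_eq_square)
  have d: "(edge_diff c e)\<^sup>2 = (c w - c r)\<^sup>2" "c (tail G e) + c (head G e) = c r + c w"
    using ends by (auto simp: edge_diff_def power2_commute)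
  show ?thesis
    unfolding deficit_def dirichlet_def edge_mass_def sums sq[OF length_nonzero[OF e]] d
    by (simp add: algebra_simps power2_eq_square power3_eq_cube add_divide_distrib diff_divide_distrib)
qed

lemma sum_length_pos: "F \<subseteq> arcs G \<Longrightarrow> F \<noteq> {} \<Longrightarrow> 0 < sum l F"
  using finite_subset[OF _ finite_arcs] length_pos by (intro sum_pos) auto

lemma sum_length_nonneg: "F \<subseteq> arcs G \<Longrightarrow> 0 \<le> sum l F"
  using length_pos by (intro sum_nonneg) (auto intro: less_imp_le)

lemma adj_head_iff:
  assumes "f \<in> F"
  shows "(r, head G f) \<in> (adj F)\<^sup>* \<longleftrightarrow> (r, tail G f) \<in> (adj F)\<^sup>*"
  using assms by (auto simp: adj_def intro: rtrancl.rtrancl_into_rtrancl)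

text \<open>
  Remove an edge \<open>e\<close> from \<open>r\<close> to \<open>w\<close>. What remains splits into the part still reachable from \<open>r\<close> and
  a part reachable from \<open>w\<close> (empty if \<open>e\<close> lies on a cycle), which is transported through \<open>e\<close>.
\<close>

lemma deficit_nonneg:
  assumes "F \<subseteq> arcs G" "r \<in> verts G" "\<And>f. f \<in> F \<Longrightarrow> (r, tail G f) \<in> (adj F)\<^sup>*"
  shows "0 \<le> deficit c F r \<and>
    (deficit c F r = 0 \<longrightarrow> chain r F \<and> (\<forall>f\<in>F. \<forall>v\<in>{tail G f, head G f}. v \<noteq> r \<longrightarrow> c r < c v))"
  using assms
proof (induction "card F" arbitrary: F r rule: less_induct)
  case less
  have fin: "finite F" using less.prems(1) by (rule finite_subset) simp
  show ?case
  proof (cases "F = {}")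
    case True
    then show ?thesis
      using less.prems(2) by (auto simp: deficit_def dirichlet_def edge_mass_def intro: chain.nil)
  next
    case False
    then obtain f where f: "f \<in> F" by blast
    \<comment> \<open>Either \<open>f\<close> itself starts at \<open>r\<close>, or the path leading
      to \<open>f\<close> leaves \<open>r\<close> through an edge of \<open>F\<close>.\<close>
    have "\<exists>e\<in>F. r \<in> {tail G e, head G e}"
      using less.prems(3)[OF f]
    proof (cases rule: converse_rtranclE)
      case base
      then show ?thesis using f by auto
    next
      case (step x)
      then show ?thesis by (auto simp: adj_def)
    qed
    then obtain e w where e: "e \<in> F" and ends: "(tail G e, head G e) \<in> {(r, w), (w, r)}"
      by auto
    have eG: "e \<in> arcs G" using e less.prems(1) by blast
    have wG: "w \<in> verts G" using ends tail_in_verts[OF eG] head_in_verts[OF eG] by auto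
    define H where "H = F - {e}"
    define Fr where "Fr = {f\<in>H. (r, tail G f) \<in> (adj H)\<^sup>*}"
    define Fw where "Fw = H - Fr"
    have F: "F = insert e (Fr \<union> Fw)" and disj: "Fr \<inter> Fw = {}" "e \<notin> Fr" "e \<notin> Fw"
      using e by (auto simp: H_def Fr_def Fw_def)
    have finr: "finite Fr" and finw: "finite Fw" using fin F by (metis finite_Un finite_insert)+
    have sub: "Fr \<subseteq> arcs G" "Fw \<subseteq> arcs G" using less.prems(1) F by auto
    have "Fr \<subset> F" "Fw \<subset> F" using F disj by blast+
    then have card: "card Fr < card F" "card Fw < card F"
      by (simp_all add: psubset_card_mono[OF fin])
    \<comment> \<open>A path in \<open>H\<close> from \<open>r\<close> only uses edges with
      reachable ends, and these lie in \<open>Fr\<close>.\<close>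
    have "(r, x) \<in> (adj Fr)\<^sup>*" if "(r, x) \<in> (adj H)\<^sup>*" for x
      using that
    proof induction
      case (step x y)
      then obtain g where g: "g \<in> H" "(x, y) \<in> {(tail G g, head G g), (head G g, tail G g)}"
        by (auto simp: adj_def)
      then have "g \<in> Fr"
        using step.hyps(1) adj_head_iff[OF g(1), of r] by (auto simp: Fr_def)
      then have "(x, y) \<in> adj Fr" using g(2) by (auto simp: adj_def)
      then show ?case using step.IH by (rule rtrancl.rtrancl_into_rtrancl[rotated])
    qed simp
    then have reach_r: "(r, tail G f) \<in> (adj Fr)\<^sup>*" if "f \<in> Fr" for f
      using that by (simp add: Fr_def)
    \<comment> \<open>A step across \<open>e\<close> lands at \<open>r\<close> or \<open>w\<close>,
      a step in \<open>Fr\<close> ends at a vertex reachable in \<open>H\<close>, and a step in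
      \<open>Fw\<close> extends whichever alternative holds already.\<close>
    have "(r, x) \<in> (adj H)\<^sup>* \<or> (w, x) \<in> (adj Fw)\<^sup>*" if "(r, x) \<in> (adj F)\<^sup>*" for x
      using that
    proof induction
      case (step x y)
      then obtain g where g: "g \<in> F" "(x, y) \<in> {(tail G g, head G g), (head G g, tail G g)}"
        by (auto simp: adj_def)
      consider "g = e" | "g \<in> Fr" | "g \<in> Fw" using g F by blast
      then show ?case
      proof cases
        case 1
        then show ?thesis using g ends by auto
      next
        case 2
        then show ?thesis using g adj_head_iff[of g H r] by (auto simp: Fr_def)
      next
        case 3
        then have "(x, y) \<in> adj Fw" "(x, y) \<in> adj H" using g by (auto simp: adj_def Fw_def)
        then show ?thesis using step.IH by (meson rtrancl.rtrancl_into_rtrancl)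
      qed
    qed simp
    then have reach_w: "(w, tail G f) \<in> (adj Fw)\<^sup>*" if "f \<in> Fw" for f
      using that less.prems(3)[of f] F by (auto simp: Fw_def Fr_def)
    note IHr = less.hyps[OF card(1) sub(1) less.prems(2) reach_r]
    note IHw = less.hyps[OF card(2) sub(2) wG reach_w]
    let ?d = "c w - c r - l e * (sum l Fw + l e / 2)"
    let ?L = "sum l Fr * (sum l Fw + l e) * (sum l Fr + sum l Fw + l e)"
    have split: "deficit c F r = deficit c Fr r + deficit c Fw w + ?d\<^sup>2 / l e + ?L"
      unfolding F by (rule deficit_split[OF finr finw disj eG ends])
    have le: "0 < l e" and m: "0 \<le> sum l Fw" and Lr: "0 \<le> sum l Fr"
      using length_pos[OF eG] sum_length_nonneg sub by auto
    have nn: "0 \<le> deficit c Fr r" "0 \<le> deficit c Fw w" "0 \<le> ?d\<^sup>2 / l e" "0 \<le> ?L"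
      using IHr IHw le m Lr by simp_all
    show ?thesis
    proof (intro conjI impI)
      show "0 \<le> deficit c F r" using split nn by simp
    next
      assume "deficit c F r = 0"
      then have z: "deficit c Fw w = 0" "?d\<^sup>2 / l e = 0" "?L = 0" using split nn by linarith+
      \<comment> \<open>The other factors of \<open>?L\<close> are positive, so no edge besides
        \<open>e\<close> remains attached to \<open>r\<close>: there is no branching at
        \<open>r\<close>, and no cycle through \<open>e\<close> with further edges.\<close>
      have "sum l Fr = 0" using z(3) le m Lr by (simp add: add_nonneg_pos less_imp_neq[symmetric])
      then have "Fr = {}" using sum_length_pos[OF sub(1)] by fastforce
      then have FwH: "Fw = H" and F': "F = insert e Fw" using F by (auto simp: Fw_def)
      have d: "c w - c r = l e * (sum l Fw + l e / 2)" using z(2) le by simp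
      \<comment> \<open>The strict increase also excludes that \<open>e\<close> is a loop.\<close>
      then have less: "c r < c w" using le m by (smt (verit) mult_pos_pos half_gt_zero)
      have not_r: "tail G f \<noteq> r \<and> head G f \<noteq> r" if "f \<in> Fw" for f
        using that \<open>Fr = {}\<close> adj_head_iff[of f H r] by (auto simp: Fr_def FwH)
      have IH: "chain w Fw" "\<forall>f\<in>Fw. \<forall>v\<in>{tail G f, head G f}. v \<noteq> w \<longrightarrow> c w < c v"
        using IHw z(1) by auto
      show "chain r F"
        unfolding F' using IH(1) eG disj(3) ends less not_r by (intro chain.step[of w]) auto
      show "\<forall>f\<in>F. \<forall>v\<in>{tail G f, head G f}. v \<noteq> r \<longrightarrow> c r < c v"
        unfolding F' using IH(2) ends less by fastforce
    qed
  qed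
qed

text \<open>The test function \<open>1\<close> says that the whole source leaves through the
  vertices. The test function \<open>c\<close> gives the energy identity, where the terms
  \<open>l e ^ 3 / 12\<close> on both sides agree.\<close>

lemma torsion_values_sums:
  assumes c: "torsion_values \<alpha> c"
  shows "(\<Sum>v\<in>verts G. \<alpha> v * c v) = sum l (arcs G)"
    and "dirichlet c (arcs G) + (\<Sum>v\<in>verts G. \<alpha> v * (c v)\<^sup>2) = edge_mass c (arcs G)"
proof -
  show "(\<Sum>v\<in>verts G. \<alpha> v * c v) = sum l (arcs G)"
    using torsion_values_weak[OF c, of "\<lambda>_. 1"] by (simp add: edge_diff_def)
  show "dirichlet c (arcs G) + (\<Sum>v\<in>verts G. \<alpha> v * (c v)\<^sup>2) = edge_mass c (arcs G)"
    using torsion_values_weak[OF c, of c]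
    by (simp add: dirichlet_def edge_mass_def sum.distrib power2_eq_square mult.assoc)
qed

text \<open>Since \<open>L / A\<close> is the weighted mean of \<open>c\<close>, the last sum is a
  weighted variance, the exact remainder in Cauchy-Schwarz. As an identity, the averaging argument
  also shows what equality means.\<close>

lemma edge_mass_bound_identity:
  fixes \<alpha> :: "'v \<Rightarrow> real"
  assumes c: "torsion_values \<alpha> c" and A: "sum \<alpha> (verts G) \<noteq> 0"
  defines "A \<equiv> sum \<alpha> (verts G)" and "L \<equiv> sum l (arcs G)"
  shows "A * (L ^ 3 / 3 + L\<^sup>2 / A - edge_mass c (arcs G)) =
    (\<Sum>v\<in>verts G. \<alpha> v * deficit c (arcs G) v) + A * (\<Sum>v\<in>verts G. \<alpha> v * (c v - L / A)\<^sup>2)"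
proof -
  let ?T = "edge_mass c (arcs G)" and ?D = "dirichlet c (arcs G)"
  let ?E = "\<Sum>v\<in>verts G. \<alpha> v * (c v)\<^sup>2"
  have A0: "A \<noteq> 0" using A by (simp add: A_def)
  have "(\<Sum>v\<in>verts G. \<alpha> v * deficit c (arcs G) v) =
      (\<Sum>v\<in>verts G. \<alpha> v * (?D + L ^ 3 / 3 - 2 * ?T) + 2 * L * (\<alpha> v * c v))"
    by (rule sum.cong) (simp_all add: deficit_def L_def algebra_simps)
  also have "\<dots> = A * (?D + L ^ 3 / 3 - 2 * ?T) + 2 * L * L"
    using torsion_values_sums(1)[OF c]
    by (simp add: sum.distrib sum_distrib_left[symmetric] sum_distrib_right[symmetric] A_def L_def)
  finally have 1: "(\<Sum>v\<in>verts G. \<alpha> v * deficit c (arcs G) v) = A * (?D + L ^ 3 / 3 - 2 * ?T) + 2 * L * L" .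
  have "(\<Sum>v\<in>verts G. \<alpha> v * (c v - L / A)\<^sup>2) =
      (\<Sum>v\<in>verts G. \<alpha> v * (c v)\<^sup>2 - 2 * (L / A) * (\<alpha> v * c v) + (L / A)\<^sup>2 * \<alpha> v)"
    by (rule sum.cong) (simp_all add: algebra_simps power2_diff)
  also have "\<dots> = ?E - 2 * (L / A) * L + (L / A)\<^sup>2 * A"
    unfolding sum.distrib sum_subtractf sum_distrib_left[symmetric] torsion_values_sums(1)[OF c] A_def L_def ..
  finally have 2: "(\<Sum>v\<in>verts G. \<alpha> v * (c v - L / A)\<^sup>2) = ?E - 2 * (L / A) * L + (L / A)\<^sup>2 * A" .
  have 3: "?D = ?T - ?E" using torsion_values_sums(2)[OF c] by (simp add: algebra_simps)
  show ?thesis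
    unfolding 1 2 3 using A0 by (simp add: field_simps power2_eq_square)
qed

text \<open>Both remainders in \<open>edge_mass_bound_identity\<close> are nonnegative. In case of
  equality the deficit vanishes at every vertex of nonzero strength, and
  \<open>deficit_nonneg\<close> supplies the chain and the strict minima.\<close>

lemma edge_mass_upper_bound:
  fixes \<alpha> :: "'v \<Rightarrow> real"
  assumes pos: "\<And>v. v \<in> verts G \<Longrightarrow> 0 \<le> \<alpha> v"
    and r: "r \<in> verts G" "\<alpha> r \<noteq> 0"
    and conn: "\<And>u v. u \<in> verts G \<Longrightarrow> v \<in> verts G \<Longrightarrow> (u, v) \<in> (adj (arcs G))\<^sup>*"
    and c: "torsion_values \<alpha> c"
  defines "A \<equiv> sum \<alpha> (verts G)" and "L \<equiv> sum l (arcs G)"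
  shows "edge_mass c (arcs G) \<le> L ^ 3 / 3 + L\<^sup>2 / A"
    and "edge_mass c (arcs G) = L ^ 3 / 3 + L\<^sup>2 / A \<Longrightarrow>
      chain r (arcs G) \<and> (\<forall>v\<in>verts G. v \<noteq> r \<longrightarrow> \<alpha> v = 0)"
proof -
  have "A > 0"
    unfolding A_def using pos r by (intro sum_pos2[of _ r]) (auto simp: less_le)
  note id = edge_mass_bound_identity[OF c, folded A_def L_def]
  have def: "0 \<le> deficit c (arcs G) v" "deficit c (arcs G) v = 0 \<Longrightarrow> chain v (arcs G)"
      "deficit c (arcs G) v = 0 \<Longrightarrow>
        \<forall>f\<in>arcs G. \<forall>u\<in>{tail G f, head G f}. u \<noteq> v \<longrightarrow> c v < c u"
    if "v \<in> verts G" for v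
    using deficit_nonneg[of "arcs G" v c] that conn by auto
  have nn: "0 \<le> \<alpha> v * deficit c (arcs G) v" if "v \<in> verts G" for v
    using def(1) pos that by simp
  have nn1: "0 \<le> (\<Sum>v\<in>verts G. \<alpha> v * deficit c (arcs G) v)"
    using nn by (rule sum_nonneg)
  have nn2: "0 \<le> A * (\<Sum>v\<in>verts G. \<alpha> v * (c v - L / A)\<^sup>2)"
    using \<open>A > 0\<close> pos by (auto intro!: mult_nonneg_nonneg sum_nonneg)
  have "0 \<le> A * (L ^ 3 / 3 + L\<^sup>2 / A - edge_mass c (arcs G))"
    using id nn1 nn2 \<open>A > 0\<close> by simp
  then show "edge_mass c (arcs G) \<le> L ^ 3 / 3 + L\<^sup>2 / A"
    using \<open>A > 0\<close> by (simp add: zero_le_mult_iff)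
  assume "edge_mass c (arcs G) = L ^ 3 / 3 + L\<^sup>2 / A"
  then have "(\<Sum>v\<in>verts G. \<alpha> v * deficit c (arcs G) v) = 0"
    using id nn1 nn2 \<open>A > 0\<close> by simp
  then have z: "\<forall>v\<in>verts G. \<alpha> v * deficit c (arcs G) v = 0"
    using sum_nonneg_eq_0_iff[OF finite_verts, of "\<lambda>v. \<alpha> v * deficit c (arcs G) v"] nn by blast
  \<comment> \<open>The last edge of a path from \<open>u\<close> to \<open>v\<close> has
    \<open>v\<close> as an end, so the comparison on edges reaches every vertex.\<close>
  have less: "c u < c v" if "u \<in> verts G" "v \<in> verts G" "\<alpha> u \<noteq> 0" "u \<noteq> v" for u v
  proof -
    have "(u, v) \<in> (adj (arcs G))\<^sup>*" using conn that by blast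
    then obtain x where "(x, v) \<in> adj (arcs G)" using \<open>u \<noteq> v\<close> by (cases rule: rtranclE) auto
    then obtain f where "f \<in> arcs G" "v \<in> {tail G f, head G f}" by (auto simp: adj_def)
    then show ?thesis using def(3)[of u] z that by force
  qed
  show "chain r (arcs G) \<and> (\<forall>v\<in>verts G. v \<noteq> r \<longrightarrow> \<alpha> v = 0)"
  proof (intro conjI ballI impI)
    show "chain r (arcs G)" using def(2)[of r] z r by auto
    \<comment> \<open>Two distinct vertices of nonzero strength would each have the strictly smaller
      value.\<close>
    show "\<alpha> v = 0" if "v \<in> verts G" "v \<noteq> r" for v
      using less[of r v] less[of v r] r that by fastforce
  qed
qed

text \<open>The variational characterization: the energy of \<open>c - g\<close> is nonnegative, and
  the weak formulation evaluates its mixed terms.\<close>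

lemma edge_mass_lower_bound:
  fixes \<alpha> g :: "'v \<Rightarrow> real"
  assumes pos: "\<And>v. v \<in> verts G \<Longrightarrow> 0 \<le> \<alpha> v"
    and c: "torsion_values \<alpha> c"
  shows "2 * edge_mass g (arcs G) - dirichlet g (arcs G) - (\<Sum>v\<in>verts G. \<alpha> v * (g v)\<^sup>2)
    \<le> edge_mass c (arcs G)"
proof -
  have "0 \<le> (\<Sum>e\<in>arcs G. (edge_diff c e - edge_diff g e)\<^sup>2 / l e)" (is "_ \<le> ?X")
    using length_pos by (intro sum_nonneg) (simp add: less_imp_le)
  moreover have "0 \<le> (\<Sum>v\<in>verts G. \<alpha> v * (c v - g v)\<^sup>2)" (is "_ \<le> ?Y")
    using pos by (intro sum_nonneg) auto
  moreover have "?X = (\<Sum>e\<in>arcs G. (edge_diff c e)\<^sup>2 / l e) + (\<Sum>e\<in>arcs G. (edge_diff g e)\<^sup>2 / l e)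
      - 2 * (\<Sum>e\<in>arcs G. edge_diff c e * edge_diff g e / l e)"
    unfolding sum_distrib_left sum.distrib[symmetric] sum_subtractf[symmetric]
    by (rule sum.cong) (auto simp: power2_diff add_divide_distrib diff_divide_distrib)
  moreover have "?Y = (\<Sum>v\<in>verts G. \<alpha> v * (c v)\<^sup>2) + (\<Sum>v\<in>verts G. \<alpha> v * (g v)\<^sup>2)
      - 2 * (\<Sum>v\<in>verts G. \<alpha> v * c v * g v)"
    unfolding sum_distrib_left sum.distrib[symmetric] sum_subtractf[symmetric]
    by (rule sum.cong) (auto simp: power2_diff algebra_simps)
  ultimately show ?thesis
    using torsion_values_weak[OF c, of g] torsion_values_sums(2)[OF c]
    by (simp add: dirichlet_def edge_mass_def sum.distrib)
qed

end

section \<open>Distances and isometries onto an interval\<close>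

context metric_graph
begin

definition edge_lipschitz :: "(('v, 'e) point \<Rightarrow> real) \<Rightarrow> bool" where
  "edge_lipschitz \<psi> \<longleftrightarrow> (\<forall>e\<in>arcs G. \<forall>x\<in>{0..l e}. \<forall>y\<in>{0..l e}.
     \<bar>\<psi> (edge_pt G l e x) - \<psi> (edge_pt G l e y)\<bar> \<le> \<bar>x - y\<bar>)"

lemma walk_length_ge:
  assumes "walk G l p q r" "edge_lipschitz \<psi>"
  shows "\<bar>\<psi> p - \<psi> q\<bar> \<le> r"
  using assms(1)
proof induction
  case (step e x r y)
  have "\<bar>\<psi> (edge_pt G l e x) - \<psi> (edge_pt G l e y)\<bar> \<le> \<bar>x - y\<bar>"
    using assms(2) step.hyps by (simp add: edge_lipschitz_def)
  then show ?case using step.IH by linarith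
qed simp

lemma walk_edge:
  assumes "e \<in> arcs G" "x \<in> {0..l e}" "y \<in> {0..l e}"
  shows "walk G l (edge_pt G l e x) (edge_pt G l e y) \<bar>x - y\<bar>"
  using walk.step[OF walk.refl[OF edge_pt_in_points[OF assms(1,2)]] assms]
  by (simp add: abs_minus_commute)

lemma walk_trans:
  assumes "walk G l p q r" "walk G l q s r'"
  shows "walk G l p s (r + r')"
  using assms(2)
proof induction
  case refl
  then show ?case using assms(1) by simp
next
  case (step e x r' y)
  then show ?case using walk.step[OF step.IH step.hyps(2-4)] by (simp add: add.assoc)
qed

lemma graph_dist_le:
  assumes "walk G l p q r"
  shows "graph_dist G l p q \<le> r"
proof -
  have "0 \<le> r'" if "walk G l p q r'" for r'
    using walk_length_ge[OF that, of "\<lambda>_. 0"] by (simp add: edge_lipschitz_def)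
  then have "bdd_below {r. walk G l p q r}" by (intro bdd_belowI) simp
  then show ?thesis
    unfolding graph_dist_def using assms by (intro cInf_lower) simp_all
qed

text \<open>The given walk ensures that the infimum is taken over a nonempty set.\<close>

lemma graph_dist_ge:
  assumes "walk G l p q r" "edge_lipschitz \<psi>"
  shows "\<bar>\<psi> p - \<psi> q\<bar> \<le> graph_dist G l p q"
  unfolding graph_dist_def using assms walk_length_ge by (intro cInf_greatest) auto

lemma graph_dist_eq:
  assumes "walk G l p q \<bar>\<psi> p - \<psi> q\<bar>" "edge_lipschitz \<psi>"
  shows "graph_dist G l p q = \<bar>\<psi> p - \<psi> q\<bar>"
  using graph_dist_le[OF assms(1)] graph_dist_ge[OF assms] by (rule antisym)

text \<open>\<open>Vertex r\<close> is added separately to cover the empty chain.\<close>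

definition chain_points :: "'v \<Rightarrow> 'e set \<Rightarrow> ('v, 'e) point set" where
  "chain_points r F = insert (Vertex r) (\<Union>e\<in>F. edge_pt G l e ` {0..l e})"

text \<open>A chain unrolls onto an interval: the new edge occupies \<open>[0, l e]\<close> and the
  old chain is shifted by \<open>l e\<close>. Differences of the position are realized by walks and,
  by the isometry on edges, also bound walk lengths from below.\<close>

lemma chain_position:
  assumes "chain r F"
  shows "F \<subseteq> arcs G \<and> finite F \<and> (\<exists>\<psi>. bij_betw \<psi> (chain_points r F) {0..sum l F} \<and> \<psi> (Vertex r) = 0 \<and>
    (\<forall>e\<in>F. \<forall>x\<in>{0..l e}. \<forall>y\<in>{0..l e}. \<bar>\<psi> (edge_pt G l e x) - \<psi> (edge_pt G l e y)\<bar> = \<bar>x - y\<bar>) \<and>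
    (\<forall>p\<in>chain_points r F. \<forall>q\<in>chain_points r F. walk G l p q \<bar>\<psi> p - \<psi> q\<bar>))"
  using assms
proof induction
  case (nil r)
  then show ?case
    by (auto simp: chain_points_def points_def bij_betw_def intro!: exI[of _ "\<lambda>_. 0"] walk.refl)
next
  case (step w F e r)
  then obtain \<psi> where FG: "F \<subseteq> arcs G" "finite F"
    and bij: "bij_betw \<psi> (chain_points w F) {0..sum l F}" and w0: "\<psi> (Vertex w) = 0"
    and iso: "\<And>e x y. \<lbrakk>e \<in> F; x \<in> {0..l e}; y \<in> {0..l e}\<rbrakk> \<Longrightarrow>
      \<bar>\<psi> (edge_pt G l e x) - \<psi> (edge_pt G l e y)\<bar> = \<bar>x - y\<bar>"
    and walk: "\<And>p q. \<lbrakk>p \<in> chain_points w F; q \<in> chain_points w F\<rbrakk> \<Longrightarrow> walk G l p q \<bar>\<psi> p - \<psi> q\<bar>"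
    by blast
  have le: "0 < l e" using length_pos step.hyps(2) .
  have m: "0 \<le> sum l F" using sum_length_nonneg FG(1) .
  let ?P = "chain_points w F" and ?E = "edge_pt G l e ` {0..l e}"
  \<comment> \<open>The distance from \<open>r\<close> along \<open>e\<close>, for either
    orientation of \<open>e\<close>.\<close>
  define \<sigma> where "\<sigma> x = (if tail G e = r then x else l e - x)" for x
  define \<xi> where "\<xi> p = (if p = Vertex r then 0 else
    (case p of Vertex v \<Rightarrow> l e + \<psi> p | Interior f x \<Rightarrow> if f = e then \<sigma> x else l e + \<psi> p))" for p
  have \<sigma>: "\<sigma> ` {0..l e} = {0..l e}"
    by (auto simp: \<sigma>_def image_iff intro: bexI[of _ "l e - x" for x])
  have \<sigma>_diff: "\<bar>\<sigma> x - \<sigma> y\<bar> = \<bar>x - y\<bar>" for x y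
    by (simp add: \<sigma>_def abs_minus_commute)
  have \<xi>_E: "\<xi> (edge_pt G l e x) = \<sigma> x" if "x \<in> {0..l e}" for x
    using that step.hyps(4,5) w0 le by (auto simp: \<xi>_def \<sigma>_def edge_pt_def)
  have P: "p \<noteq> Vertex r \<and> (\<forall>x. p \<noteq> Interior e x)" if "p \<in> ?P" for p
    using that step.hyps(3,5,6) by (auto simp: chain_points_def edge_pt_def split: if_splits)
  have \<xi>_P: "\<xi> p = l e + \<psi> p" if "p \<in> ?P" for p
    using P[OF that] by (auto simp: \<xi>_def split: point.split)
  have wP: "Vertex w \<in> ?P" by (simp add: chain_points_def)
  obtain xw where xw: "xw \<in> {0..l e}" "edge_pt G l e xw = Vertex w" "\<sigma> xw = l e"
    and r_E: "Vertex r \<in> ?E"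
  proof (cases "tail G e = r")
    case True
    then show ?thesis using that[of "l e"] step.hyps(2,4,5) le
      by (force simp: \<sigma>_def image_iff intro: bexI[of _ 0])
  next
    case False
    then show ?thesis using that[of 0] step.hyps(2,4,5) le
      by (force simp: \<sigma>_def image_iff intro: bexI[of _ "l e"])
  qed
  have points: "chain_points r (insert e F) = ?E \<union> ?P"
  proof -
    have "Vertex w \<in> ?E" using xw(1,2) by (metis image_eqI)
    then show ?thesis using r_E unfolding chain_points_def by blast
  qed
  have psi: "0 \<le> \<psi> p" "\<psi> p \<le> sum l F" if "p \<in> ?P" for p
    using bij_betwE[OF bij] that by auto
  have \<sigma>_le: "0 \<le> \<sigma> x" "\<sigma> x \<le> l e" if "x \<in> {0..l e}" for x
    using that by (auto simp: \<sigma>_def)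
  have "\<xi> ` (?E \<union> ?P) = {0..sum l (insert e F)}"
  proof -
    have "\<xi> ` ?E = {0..l e}" unfolding image_image using \<xi>_E \<sigma> by (simp cong: image_cong_simp)
    moreover have "\<xi> ` ?P = (+) (l e) ` (\<psi> ` ?P)" unfolding image_image using \<xi>_P by (simp cong: image_cong_simp)
    then have "\<xi> ` ?P = {l e..l e + sum l F}"
      using bij by (simp add: bij_betw_def image_add_atLeastAtMost add.commute)
    ultimately show ?thesis
      using le m FG(2) step.hyps(3) by (auto simp: image_Un)
  qed
  \<comment> \<open>The images of \<open>?E\<close> and \<open>?P\<close> share only the value
    \<open>l e\<close>, which both attain only at \<open>Vertex w\<close>.\<close>
  moreover have cross: "p = q" if pq: "p \<in> ?E" "q \<in> ?P" "\<xi> p = \<xi> q" for p q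
  proof -
    obtain x where x: "x \<in> {0..l e}" "p = edge_pt G l e x" using pq(1) by blast
    have "\<sigma> x = l e" "\<psi> q = 0"
      using pq(3) \<xi>_E[OF x(1)] x(2) \<xi>_P[OF pq(2)] \<sigma>_le[OF x(1)] psi[OF pq(2)] by auto
    then have "x = xw" "q = Vertex w"
      using xw \<sigma>_diff[of x xw] bij_betw_imp_inj_on[OF bij, THEN inj_onD, of q "Vertex w"] w0 pq(2) wP
      by auto
    then show ?thesis using x xw by simp
  qed
  have "inj_on \<xi> (?E \<union> ?P)"
  proof (rule inj_onI)
    fix p q assume p: "p \<in> ?E \<union> ?P" and q: "q \<in> ?E \<union> ?P" and eq: "\<xi> p = \<xi> q"
    have E: "p = q" if pqE: "p \<in> ?E" "q \<in> ?E"
    proof -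
      obtain x y where xy: "x \<in> {0..l e}" "p = edge_pt G l e x" "y \<in> {0..l e}" "q = edge_pt G l e y"
        using pqE by blast
      then have "\<sigma> x = \<sigma> y" using eq \<xi>_E by simp
      then show ?thesis using \<sigma>_diff[of x y] xy by simp
    qed
    have "p = q" if "p \<in> ?P" "q \<in> ?P"
      using eq that \<xi>_P bij_betw_imp_inj_on[OF bij, THEN inj_onD, of p q] by simp
    then show "p = q" using E cross[of p q] cross[of q p] p q eq by auto
  qed
  ultimately have bij': "bij_betw \<xi> (chain_points r (insert e F)) {0..sum l (insert e F)}"
    unfolding points by (simp add: bij_betw_def)
  have iso': "\<bar>\<xi> (edge_pt G l f x) - \<xi> (edge_pt G l f y)\<bar> = \<bar>x - y\<bar>"
    if "f \<in> insert e F" "x \<in> {0..l f}" "y \<in> {0..l f}" for f x y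
  proof (cases "f = e")
    case True
    then show ?thesis using that \<xi>_E \<sigma>_diff by simp
  next
    case False
    then have "f \<in> F" using that(1) by simp
    then have "edge_pt G l f x \<in> ?P" "edge_pt G l f y \<in> ?P"
      using that(2,3) unfolding chain_points_def by blast+
    then show ?thesis using \<xi>_P iso[OF \<open>f \<in> F\<close> that(2,3)] by simp
  qed
  \<comment> \<open>Walks are joined at \<open>Vertex w\<close>; their lengths add up because
    \<open>\<xi>\<close> is at most \<open>l e\<close> on \<open>?E\<close> and at least
    \<open>l e\<close> on \<open>?P\<close>.\<close>
  have EP: "walk G l p q \<bar>\<xi> p - \<xi> q\<bar>" "walk G l q p \<bar>\<xi> q - \<xi> p\<bar>"
    if pq: "p \<in> ?E" "q \<in> ?P" for p q
  proof -
    obtain x where x: "x \<in> {0..l e}" "p = edge_pt G l e x" using pq(1) by blast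
    have len: "\<bar>x - xw\<bar> = l e - \<xi> p" "\<bar>xw - x\<bar> = l e - \<xi> p"
      using \<sigma>_diff[of x xw] \<sigma>_le[OF x(1)] xw(3) \<xi>_E[OF x(1)] x(2) by auto
    have "\<bar>\<xi> p - \<xi> q\<bar> = \<bar>x - xw\<bar> + \<bar>\<psi> (Vertex w) - \<psi> q\<bar>"
        "\<bar>\<xi> q - \<xi> p\<bar> = \<bar>\<psi> q - \<psi> (Vertex w)\<bar> + \<bar>xw - x\<bar>"
      using len \<xi>_P[OF pq(2)] psi[OF pq(2)] \<sigma>_le[OF x(1)] \<xi>_E[OF x(1)] x(2) w0 by auto
    then show "walk G l p q \<bar>\<xi> p - \<xi> q\<bar>" "walk G l q p \<bar>\<xi> q - \<xi> p\<bar>"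
      using walk_trans[OF walk_edge[OF step.hyps(2) x(1) xw(1)] walk[OF wP pq(2), folded xw(2)]]
        walk_trans[OF walk[OF pq(2) wP, folded xw(2)] walk_edge[OF step.hyps(2) xw(1) x(1)]] x(2) xw(2)
      by simp_all
  qed
  have "walk G l p q \<bar>\<xi> p - \<xi> q\<bar>"
    if pq: "p \<in> chain_points r (insert e F)" "q \<in> chain_points r (insert e F)" for p q
  proof -
    have "walk G l p q \<bar>\<xi> p - \<xi> q\<bar>" if "p \<in> ?E" "q \<in> ?E"
      using that walk_edge[OF step.hyps(2)] \<xi>_E \<sigma>_diff by fastforce
    moreover have "walk G l p q \<bar>\<xi> p - \<xi> q\<bar>" if "p \<in> ?P" "q \<in> ?P"
      using walk[OF that] \<xi>_P that by simp
    ultimately show ?thesis using pq EP unfolding points by blast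
  qed
  moreover have "\<xi> (Vertex r) = 0" by (simp add: \<xi>_def)
  ultimately show ?case
    using bij' iso' FG step.hyps(2) by (intro conjI exI[of _ \<xi>]) auto
qed

lemma points_eq_edges:
  assumes "\<And>v. v \<in> verts G \<Longrightarrow> v = r \<or> (\<exists>e\<in>arcs G. v \<in> {tail G e, head G e})" "r \<in> verts G"
  shows "points G l = chain_points r (arcs G)"
proof
  have "Vertex r \<in> points G l" using assms(2) by (simp add: points_def)
  then show "chain_points r (arcs G) \<subseteq> points G l"
    using edge_pt_in_points by (auto simp: chain_points_def)
  show "points G l \<subseteq> chain_points r (arcs G)"
  proof
    fix p assume "p \<in> points G l"
    then consider v where "v \<in> verts G" "p = Vertex v" |
      e x where "e \<in> arcs G" "0 < x" "x < l e" "p = Interior e x"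
      by (auto simp: points_def)
    then show "p \<in> chain_points r (arcs G)"
    proof cases
      case (1 v)
      have "Vertex (tail G e) \<in> edge_pt G l e ` {0..l e}" "Vertex (head G e) \<in> edge_pt G l e ` {0..l e}"
        if "e \<in> arcs G" for e
        using length_pos[OF that] that
        by (auto simp: image_iff intro: bexI[of _ 0] bexI[of _ "l e"])
      then show ?thesis using 1 assms(1)[of v] by (auto simp: chain_points_def)
    next
      case (2 e x)
      then show ?thesis
        by (auto simp: chain_points_def image_iff edge_pt_interior intro!: bexI[of _ e] bexI[of _ x])
    qed
  qed
qed

section \<open>Topological connectedness and combinatorial reachability\<close>

lemma topspace_graph_topology: "topspace (graph_topology G l) = points G l"
proof (rule antisym)
  show "topspace (graph_topology G l) \<subseteq> points G l"
    using openin_topspace[of "graph_topology G l"] unfolding openin_graph_topology by blast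
  have "{x \<in> {0..l e}. edge_pt G l e x \<in> points G l} = {0..l e}" if "e \<in> arcs G" for e
    using edge_pt_in_points that by blast
  then have "openin (graph_topology G l) (points G l)"
    unfolding openin_graph_topology by simp
  then show "points G l \<subseteq> topspace (graph_topology G l)" by (rule openin_subset)
qed

text \<open>An edge has both ends reachable from \<open>u\<close> or neither, so the reachable
  vertices with their edges form a clopen set, which must be the whole space.\<close>

lemma connected_graph_adj:
  assumes "connected_graph G l" and u: "u \<in> verts G" and v: "v \<in> verts G"
  shows "(u, v) \<in> (adj (arcs G))\<^sup>*"
proof -
  define R where "R = {w. (u, w) \<in> (adj (arcs G))\<^sup>*}"
  define U where "U = {p \<in> points G l. case p of Vertex w \<Rightarrow> w \<in> R | Interior e x \<Rightarrow> tail G e \<in> R}"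
  have ends: "head G e \<in> R \<longleftrightarrow> tail G e \<in> R" if "e \<in> arcs G" for e
    using adj_head_iff[OF that] by (simp add: R_def)
  have mem: "edge_pt G l e x \<in> U \<longleftrightarrow> tail G e \<in> R" if "e \<in> arcs G" "x \<in> {0..l e}" for e x
    using edge_pt_in_points[OF that] ends[OF that(1)] by (auto simp: U_def edge_pt_def)
  have "{x \<in> {0..l e}. edge_pt G l e x \<in> U} = (if tail G e \<in> R then {0..l e} else {})"
      "{x \<in> {0..l e}. edge_pt G l e x \<in> points G l - U} = (if tail G e \<in> R then {} else {0..l e})"
    if "e \<in> arcs G" for e
    using mem[OF that] edge_pt_in_points[OF that] by auto
  then have "openin (graph_topology G l) U" "openin (graph_topology G l) (points G l - U)"
    unfolding openin_graph_topology by (auto simp: U_def)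
  then have "closedin (graph_topology G l) U"
    unfolding closedin_def topspace_graph_topology by (auto simp: U_def)
  moreover have "connected_space (graph_topology G l)"
    using assms(1) unfolding connected_graph_def by (rule path_connected_imp_connected_space)
  ultimately have "U = {} \<or> U = points G l"
    using \<open>openin (graph_topology G l) U\<close>
    unfolding connected_space_clopen_in topspace_graph_topology by blast
  moreover have "Vertex u \<in> U" using u by (simp add: U_def points_def R_def)
  ultimately have "Vertex v \<in> U" using v by (auto simp: points_def)
  then show ?thesis by (simp add: U_def R_def)
qed

end

text \<open>An isometry of each half into the line has slope \<open>1\<close> or \<open>- 1\<close>.
  Opposite slopes would map the quarter points, which are symmetric about the middle, to the same
  value.\<close>

lemma isometric_halves_imp_affine:
  fixes f :: "real \<Rightarrow> real"
  assumes a: "0 < a"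
    and left: "\<And>x y. x \<in> {0..a / 2} \<Longrightarrow> y \<in> {0..a / 2} \<Longrightarrow> \<bar>f x - f y\<bar> = \<bar>x - y\<bar>"
    and right: "\<And>x y. x \<in> {a / 2..a} \<Longrightarrow> y \<in> {a / 2..a} \<Longrightarrow> \<bar>f x - f y\<bar> = \<bar>x - y\<bar>"
    and inj: "f (a / 4) \<noteq> f (3 * a / 4)"
  obtains s where "s \<in> {1, - 1}" "\<And>x. x \<in> {0..a} \<Longrightarrow> f x = f 0 + s * x"
proof -
  let ?m = "a / 2"
  \<comment> \<open>The distances to both ends of a half determine \<open>f x\<close> once the end
    values are known.\<close>
  have l0: "f x \<le> f 0 + x" "f 0 - x \<le> f x" "f x \<le> f ?m + (?m - x)" "f ?m - (?m - x) \<le> f x"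
    if "0 \<le> x" "x \<le> ?m" for x
    using left[of x 0] left[of x ?m] that a by auto
  have r0: "f x \<le> f ?m + (x - ?m)" "f ?m - (x - ?m) \<le> f x" "f x \<le> f a + (a - x)" "f a - (a - x) \<le> f x"
    if "?m \<le> x" "x \<le> a" for x
    using right[of x ?m] right[of x a] that a by auto
  consider "f ?m = f 0 + ?m" "f a = f ?m + ?m" | "f ?m = f 0 + ?m" "f a = f ?m - ?m" |
    "f ?m = f 0 - ?m" "f a = f ?m + ?m" | "f ?m = f 0 - ?m" "f a = f ?m - ?m"
  proof -
    have "f ?m = f 0 + ?m \<or> f ?m = f 0 - ?m" "f a = f ?m + ?m \<or> f a = f ?m - ?m"
      using left[of ?m 0] right[of a ?m] a by (auto simp: abs_if split: if_splits)
    then show thesis using that by blast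
  qed
  moreover have q: "0 \<le> a / 4" "a / 4 \<le> ?m" "?m \<le> 3 * a / 4" "3 * a / 4 \<le> a"
    using a by auto
  ultimately show thesis
  proof cases
    case 1
    have "f x = f 0 + 1 * x" if "x \<in> {0..a}" for x
    proof -
      have x: "0 \<le> x" "x \<le> a" using that by auto
      show ?thesis
      proof (cases "x \<le> ?m")
        case True
        show ?thesis using l0[OF x(1) True] 1 by linarith
      next
        case False
        then have m: "?m \<le> x" by simp
        show ?thesis using r0[OF m x(2)] 1 by linarith
      qed
    qed
    then show thesis using that[of 1] by blast
  next
    case 4
    have "f x = f 0 + (- 1) * x" if "x \<in> {0..a}" for x
    proof -
      have x: "0 \<le> x" "x \<le> a" using that by auto
      show ?thesis
      proof (cases "x \<le> ?m")
        case True
        show ?thesis using l0[OF x(1) True] 4 by linarith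
      next
        case False
        then have m: "?m \<le> x" by simp
        show ?thesis using r0[OF m x(2)] 4 by linarith
      qed
    qed
    then show thesis using that[of "- 1"] by blast
  next
    case 2
    have "f (a / 4) = f (3 * a / 4)"
      using l0[OF q(1,2)] r0[OF q(3,4)] 2 by linarith
    then show thesis using inj by contradiction
  next
    case 3
    have "f (a / 4) = f (3 * a / 4)"
      using l0[OF q(1,2)] r0[OF q(3,4)] 3 by linarith
    then show thesis using inj by contradiction
  qed
qed

text \<open>Nonoverlapping intervals of total length \<open>L\<close> inside \<open>{0..L}\<close>
  cover it up to a null set, so both sides are the integral of \<open>h\<close>. This avoids sorting
  the intervals in order to telescope.\<close>

lemma sum_increments_tiling:
  fixes H h p a :: "_ \<Rightarrow> real"
  assumes fin: "finite F" and a: "\<And>e. e \<in> F \<Longrightarrow> 0 < a e"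
    and sub: "\<And>e. e \<in> F \<Longrightarrow> {p e..p e + a e} \<subseteq> {0..L}"
    and disj: "\<And>e f. e \<in> F \<Longrightarrow> f \<in> F \<Longrightarrow> e \<noteq> f \<Longrightarrow> {p e<..<p e + a e} \<inter> {p f<..<p f + a f} = {}"
    and L: "sum a F = L" "0 \<le> L"
    and H: "\<And>x. (H has_real_derivative h x) (at x)"
  shows "(\<Sum>e\<in>F. H (p e + a e) - H (p e)) = H L - H 0"
proof -
  define U where "U = (\<Union>e\<in>F. {p e..p e + a e})"
  have ftc: "(H' has_integral K y - K x) {x..y}"
    if "x \<le> y" "\<And>x. (K has_real_derivative H' x) (at x)" for K H' :: "real \<Rightarrow> real" and x y
    using that
    by (intro fundamental_theorem_of_calculus)
      (auto intro: has_field_derivative_at_within simp flip: has_real_derivative_iff_has_vector_derivative)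
  have neg: "negligible ({p e..p e + a e} \<inter> {p f..p f + a f})" if "e \<in> F" "f \<in> F" "e \<noteq> f" for e f
  proof (rule negligible_subset)
    show "negligible {p e, p e + a e, p f, p f + a f}" by (rule negligible_finite) simp
    show "{p e..p e + a e} \<inter> {p f..p f + a f} \<subseteq> {p e, p e + a e, p f, p f + a f}"
      using disj[OF that] by fastforce
  qed
  have union: "(H' has_integral (\<Sum>e\<in>F. K (p e + a e) - K (p e))) U"
    if "\<And>x. (K has_real_derivative H' x) (at x)" for K H' :: "real \<Rightarrow> real"
    unfolding U_def
    using fin neg a that by (intro has_integral_UN ftc) (auto simp: pairwise_def less_imp_le)
  have U: "U \<in> lmeasurable"
    unfolding U_def using fin by (intro fmeasurable.finite_UN) auto
  \<comment> \<open>The identity as primitive computes the measure of \<open>U\<close>.\<close>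
  have "((\<lambda>x. 1 :: real) has_integral L) U"
    using union[of "\<lambda>x. x" "\<lambda>_. 1"] L(1) by (simp add: DERIV_ident)
  then have "measure lebesgue U = L"
    using lmeasure_integral[OF U] by (simp add: integral_unique)
  moreover have UL: "U \<subseteq> {0..L}" unfolding U_def using sub by blast
  moreover have IL: "{0..L} \<in> lmeasurable" using lmeasurable_cbox[of 0 L] by simp
  ultimately have "measure lebesgue ({0..L} - U) = 0"
    using L(2) U by (subst measurable_measure_Diff) (auto intro: fmeasurableD)
  then have "negligible ({0..L} - U)"
    unfolding negligible_iff_measure using fmeasurable.Diff[OF IL U] by simp
  then have "negligible {x \<in> {0..L} - U. h x \<noteq> 0}"
    by (rule negligible_subset) blast
  moreover have "{x \<in> U - {0..L}. h x \<noteq> 0} = {}" using UL by blast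
  ultimately have "(h has_integral (\<Sum>e\<in>F. H (p e + a e) - H (p e))) {0..L}"
    using has_integral_spike_set_eq[of U "{0..L}" h] union[OF H] by (metis (lifting) negligible_empty)
  then show ?thesis
    using ftc[OF L(2) H] by (rule has_integral_unique)
qed

section \<open>Edges under an isometric embedding into the line\<close>

context metric_graph
begin

text \<open>The tent over \<open>e\<close>, extended by zero, is a potential with Lipschitz constant
  one. It bounds distances on \<open>e\<close> from below even if there are shortcuts outside
  \<open>e\<close>.\<close>

lemma edge_tent:
  assumes e: "e \<in> arcs G"
    and conn: "walk G l (edge_pt G l e x) (edge_pt G l e y) r"
    and xy: "x \<in> {0..l e}" "y \<in> {0..l e}"
  shows "\<bar>min x (l e - x) - min y (l e - y)\<bar> \<le> graph_dist G l (edge_pt G l e x) (edge_pt G l e y)"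
proof -
  define \<psi> :: "('v, 'e) point \<Rightarrow> real" where
    "\<psi> p = (case p of Vertex _ \<Rightarrow> 0 | Interior f z \<Rightarrow> if f = e then min z (l e - z) else 0)" for p
  have \<psi>: "\<psi> (edge_pt G l f z) = (if f = e then min z (l e - z) else 0)" if "f \<in> arcs G" "z \<in> {0..l f}" for f z
    using that length_pos[OF that(1)]
    by (cases "z = 0"; cases "z = l f") (auto simp: \<psi>_def edge_pt_def min_def)
  have "\<bar>min u (a - u) - min v (a - v)\<bar> \<le> \<bar>u - v\<bar>" for u v a :: real
    by linarith
  then have "edge_lipschitz \<psi>"
    unfolding edge_lipschitz_def by (simp add: \<psi>)
  from graph_dist_ge[OF conn this] show ?thesis using \<psi> e xy by simp
qed

text \<open>
  The distance of two points of an edge may be smaller than their distance along the edge. But the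
  tent function shows that each half of the edge is embedded isometrically, and injectivity excludes
  that the two halves are folded onto each other.
\<close>

lemma isometric_edge_affine:
  assumes inj: "inj_on \<psi> (points G l)"
    and iso: "\<And>p q. p \<in> points G l \<Longrightarrow> q \<in> points G l \<Longrightarrow> \<bar>\<psi> p - \<psi> q\<bar> = graph_dist G l p q"
    and e: "e \<in> arcs G"
  obtains s where "s \<in> {1, - 1}" "\<And>x. x \<in> {0..l e} \<Longrightarrow> \<psi> (edge_pt G l e x) = \<psi> (Vertex (tail G e)) + s * x"
proof -
  define f where "f x = \<psi> (edge_pt G l e x)" for x
  have le: "0 < l e" using length_pos e .
  have upper: "\<bar>f x - f y\<bar> \<le> \<bar>x - y\<bar>" and lower: "\<bar>min x (l e - x) - min y (l e - y)\<bar> \<le> \<bar>f x - f y\<bar>"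
    if xy: "x \<in> {0..l e}" "y \<in> {0..l e}" for x y
    unfolding f_def iso[OF edge_pt_in_points[OF e xy(1)] edge_pt_in_points[OF e xy(2)]]
    using graph_dist_le[OF walk_edge[OF e xy]] edge_tent[OF e walk_edge[OF e xy] xy] by auto
  have "f (l e / 4) \<noteq> f (3 * l e / 4)"
  proof
    assume "f (l e / 4) = f (3 * l e / 4)"
    then have "edge_pt G l e (l e / 4) = edge_pt G l e (3 * l e / 4)"
      unfolding f_def using le by (intro inj_onD[OF inj]) (auto intro!: edge_pt_in_points e)
    then show False using le by (simp add: edge_pt_def)
  qed
  moreover have "\<bar>f x - f y\<bar> = \<bar>x - y\<bar>" if "x \<in> {0..l e / 2}" "y \<in> {0..l e / 2}" for x y
    using upper[of x y] lower[of x y] that by (simp add: min_def split: if_splits)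
  moreover have "\<bar>f x - f y\<bar> = \<bar>x - y\<bar>" if "x \<in> {l e / 2..l e}" "y \<in> {l e / 2..l e}" for x y
    using upper[of x y] lower[of x y] that le by (simp add: min_def split: if_splits)
  ultimately obtain s where "s \<in> {1, - 1}" "\<And>x. x \<in> {0..l e} \<Longrightarrow> f x = f 0 + s * x"
    using isometric_halves_imp_affine[OF le] by metis
  then show thesis using that[of s] by (simp add: f_def)
qed

text \<open>The torsion function of the interval, composed with \<open>\<psi>\<close>, is inserted
  into \<open>edge_mass_lower_bound\<close>. Its value there is the rigidity of the interval,
  because the images of the edges tile \<open>{0..L}\<close>.\<close>

lemma isometric_edge_mass_ge:
  fixes \<alpha> :: "'v \<Rightarrow> real"
  defines "L \<equiv> sum l (arcs G)" and "A \<equiv> sum \<alpha> (verts G)"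
  assumes pos: "\<And>v. v \<in> verts G \<Longrightarrow> 0 \<le> \<alpha> v"
    and c: "torsion_values \<alpha> c"
    and inj: "inj_on \<psi> (points G l)"
    and iso: "\<And>p q. p \<in> points G l \<Longrightarrow> q \<in> points G l \<Longrightarrow> \<bar>\<psi> p - \<psi> q\<bar> = graph_dist G l p q"
    and range: "\<And>p. p \<in> points G l \<Longrightarrow> \<psi> p \<in> {0..L}"
    and supp: "\<And>v. v \<in> verts G \<Longrightarrow> \<alpha> v \<noteq> 0 \<Longrightarrow> \<psi> (Vertex v) = 0"
    and A: "A \<noteq> 0"
  shows "L ^ 3 / 3 + L\<^sup>2 / A \<le> edge_mass c (arcs G)"
proof -
  have "\<exists>s. \<forall>e\<in>arcs G. s e \<in> {1, - 1} \<and>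
      (\<forall>x\<in>{0..l e}. \<psi> (edge_pt G l e x) = \<psi> (Vertex (tail G e)) + s e * x)"
    using isometric_edge_affine[OF inj iso] by (intro bchoice) metis
  then obtain s where sx: "\<forall>e\<in>arcs G. s e \<in> {1, - 1} \<and>
      (\<forall>x\<in>{0..l e}. \<psi> (edge_pt G l e x) = \<psi> (Vertex (tail G e)) + s e * x)" ..
  have s: "\<And>e. e \<in> arcs G \<Longrightarrow> s e = 1 \<or> s e = - 1"
    and \<psi>: "\<And>e x. e \<in> arcs G \<Longrightarrow> x \<in> {0..l e} \<Longrightarrow> \<psi> (edge_pt G l e x) = \<psi> (Vertex (tail G e)) + s e * x"
    using sx by auto
  \<comment> \<open>The left end of the image interval of \<open>e\<close>, for either sign
    \<open>s e\<close>.\<close>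
  define p where "p e = min (\<psi> (Vertex (tail G e))) (\<psi> (Vertex (head G e)))" for e
  have ends: "\<psi> (Vertex (tail G e)) = p e \<and> \<psi> (Vertex (head G e)) = p e + l e \<and> s e = 1 \<or>
      \<psi> (Vertex (head G e)) = p e \<and> \<psi> (Vertex (tail G e)) = p e + l e \<and> s e = - 1" if "e \<in> arcs G" for e
    using \<psi>[OF that, of "l e"] s[OF that] length_pos[OF that] that by (auto simp: p_def min_def)
  have L: "0 \<le> L" unfolding L_def by (rule sum_length_nonneg) simp
  have sub: "{p e..p e + l e} \<subseteq> {0..L}" if "e \<in> arcs G" for e
    using ends[OF that] range[of "Vertex (tail G e)"] range[of "Vertex (head G e)"] that
    by (auto simp: points_def)
  have preimage: "\<exists>x. 0 < x \<and> x < l e \<and> z = \<psi> (Interior e x)"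
    if e: "e \<in> arcs G" and z: "z \<in> {p e<..<p e + l e}" for e z
  proof -
    let ?x = "if s e = 1 then z - p e else p e + l e - z"
    have "0 < ?x \<and> ?x < l e" using z by auto
    moreover from this have "z = \<psi> (Interior e ?x)"
      using \<psi>[OF e, of ?x] ends[OF e] by (auto simp: edge_pt_interior split: if_splits)
    ultimately show ?thesis by blast
  qed
  have disj: "{p e<..<p e + l e} \<inter> {p f<..<p f + l f} = {}"
    if ef: "e \<in> arcs G" "f \<in> arcs G" "e \<noteq> f" for e f
  proof (rule ccontr)
    assume "{p e<..<p e + l e} \<inter> {p f<..<p f + l f} \<noteq> {}"
    then obtain z where "z \<in> {p e<..<p e + l e}" "z \<in> {p f<..<p f + l f}" by blast
    then obtain x y where "0 < x" "x < l e" "0 < y" "y < l f" "\<psi> (Interior e x) = \<psi> (Interior f y)"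
      using preimage[OF ef(1)] preimage[OF ef(2)] by metis
    then have "Interior e x = (Interior f y :: ('v, 'e) point)"
      using ef by (intro inj_onD[OF inj]) (auto simp: points_def)
    then show False using ef by simp
  qed
  \<comment> \<open>The torsion function of the interval with strength \<open>A\<close> at
    \<open>0\<close> and a Neumann condition at \<open>L\<close>.\<close>
  define \<theta> where "\<theta> x = L / A + L * x - x\<^sup>2 / 2" for x
  define g where "g v = \<theta> (\<psi> (Vertex v))" for v
  \<comment> \<open>A primitive of \<open>2 * \<theta> - \<theta>'\<^sup>2\<close>, the density of
    twice the mass minus the Dirichlet energy.\<close>
  define H where "H x = 2 * (L / A * x + L * x\<^sup>2 / 2 - x ^ 3 / 6) + (L - x) ^ 3 / 3" for x
  have H: "(H has_real_derivative 2 * \<theta> x - (L - x)\<^sup>2) (at x)" for x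
    unfolding H_def \<theta>_def
    using A by (auto intro!: derivative_eq_intros simp: power2_eq_square)
  \<comment> \<open>As \<open>\<theta>'' = - 1\<close>, the closed forms in \<open>edge_mass\<close>
    and \<open>dirichlet\<close> are the integrals of \<open>\<theta>\<close> and
    \<open>\<theta>'\<^sup>2\<close> over an image interval.\<close>
  have increment: "2 * (a * (\<theta> q + \<theta> (q + a)) / 2 + a ^ 3 / 12) - ((\<theta> (q + a) - \<theta> q)\<^sup>2 / a + a ^ 3 / 12) =
      H (q + a) - H q" if "a \<noteq> 0" for q a
  proof -
    have "\<theta> (q + a) - \<theta> q = a * (L - q - a / 2)"
      by (simp add: \<theta>_def field_simps power2_eq_square)
    then have sq: "(\<theta> (q + a) - \<theta> q)\<^sup>2 / a = a * (L - q - a / 2)\<^sup>2"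
      using that by (simp add: power2_eq_square)
    show ?thesis
      unfolding sq by (simp add: H_def \<theta>_def algebra_simps power2_eq_square power3_eq_cube
          add_divide_distrib diff_divide_distrib)
  qed
  have "2 * edge_mass g (arcs G) - dirichlet g (arcs G) =
      (\<Sum>e\<in>arcs G. 2 * (l e * (g (tail G e) + g (head G e)) / 2 + l e ^ 3 / 12) -
        ((edge_diff g e)\<^sup>2 / l e + l e ^ 3 / 12))"
    unfolding edge_mass_def dirichlet_def sum_subtractf sum_distrib_left ..
  also have "\<dots> = (\<Sum>e\<in>arcs G. H (p e + l e) - H (p e))"
  proof (rule sum.cong)
    fix e assume e: "e \<in> arcs G"
    show "2 * (l e * (g (tail G e) + g (head G e)) / 2 + l e ^ 3 / 12) -
        ((edge_diff g e)\<^sup>2 / l e + l e ^ 3 / 12) = H (p e + l e) - H (p e)"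
      unfolding increment[OF length_nonzero[OF e], symmetric]
      using ends[OF e] by (auto simp: g_def edge_diff_def power2_commute add.commute)
  qed simp
  also have "\<dots> = H L - H 0"
    using length_pos sub disj L H by (intro sum_increments_tiling[where L = L]) (auto simp: L_def)
  finally have mass: "2 * edge_mass g (arcs G) - dirichlet g (arcs G) = H L - H 0" .
  have "(\<Sum>v\<in>verts G. \<alpha> v * (g v)\<^sup>2) = (\<Sum>v\<in>verts G. \<alpha> v * (L / A)\<^sup>2)"
  proof (rule sum.cong)
    fix v assume "v \<in> verts G"
    then show "\<alpha> v * (g v)\<^sup>2 = \<alpha> v * (L / A)\<^sup>2"
      using supp[of v] by (cases "\<alpha> v = 0") (simp_all add: g_def \<theta>_def)
  qed simp
  also have "\<dots> = A * (L / A)\<^sup>2"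
    unfolding A_def sum_distrib_right ..
  also have "\<dots> = L\<^sup>2 / A"
    using A by (simp add: power2_eq_square)
  finally have "H L - H 0 - L\<^sup>2 / A \<le> edge_mass c (arcs G)"
    using edge_mass_lower_bound[OF pos c, of g] mass by simp
  moreover have "H L - H 0 - L\<^sup>2 / A = L ^ 3 / 3 + L\<^sup>2 / A"
    by (simp add: H_def power2_eq_square power3_eq_cube field_simps)
  ultimately show ?thesis by simp
qed

end

section \<open>The interval as a path graph\<close>

lemma metric_graph_path: "0 < L \<Longrightarrow> metric_graph path_graph (path_length L)"
  by unfold_locales (auto simp: path_graph_def path_length_def)

lemma torsional_rigidity_path:
  assumes "0 < L" "0 < A"
  shows "torsional_rigidity path_graph (path_length L) (path_strengths 0 A) = L ^ 3 / 3 + L\<^sup>2 / A"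
proof -
  interpret path: metric_graph path_graph "path_length L"
    using assms(1) by (rule metric_graph_path)
  \<comment> \<open>The flux \<open>L\<close> through the end \<open>True\<close> forces the value
    \<open>L / A\<close> there; a parabola with zero slope at the Neumann end is higher by
    \<open>L\<^sup>2 / 2\<close> at that end.\<close>
  define c where "c v = (if v then L / A else L / A + L\<^sup>2 / 2)" for v
  have inout: "out_arcs path_graph False = {()}" "out_arcs path_graph True = {}"
      "in_arcs path_graph False = {}" "in_arcs path_graph True = {()}"
    by (auto simp: out_arcs_def in_arcs_def path_graph_def)
  have ends: "head path_graph () = True" "tail path_graph () = False"
    by (simp_all add: path_graph_def)
  have diff: "path.edge_diff c () = - L\<^sup>2 / 2"
    by (simp add: path.edge_diff_def c_def ends)
  have "path.vertex_form (path_strengths 0 A) c v = path.vertex_load v" for v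
    unfolding path.vertex_form_def path.vertex_load_def
    using assms by (cases v)
      (simp_all add: inout diff, simp_all add: path_length_def path_strengths_def c_def power2_eq_square)
  then have c: "path.torsion_values (path_strengths 0 A) c"
    by (simp add: path.torsion_values_def)
  have "() \<in> arcs path_graph" by (simp add: path_graph_def)
  then have "(True, False) \<in> path.adj (arcs path_graph)"
    by (auto simp: path.adj_def ends intro!: bexI[of _ "()"])
  then have "(True, v) \<in> (path.adj (arcs path_graph))\<^sup>*" for v
    by (cases v) auto
  then have "torsional_rigidity path_graph (path_length L) (path_strengths 0 A) =
      (\<Sum>e\<in>arcs path_graph. path_length L e * (c (tail path_graph e) + c (head path_graph e)) / 2 + path_length L e ^ 3 / 12)"
    using assms by (intro path.torsional_rigidity_eq[where r = True] c)
      (auto simp: path_strengths_def path_graph_def)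
  also have "\<dots> = L ^ 3 / 3 + L\<^sup>2 / A"
    using assms by (simp add: path_graph_def path_length_def c_def field_simps power2_eq_square power3_eq_cube)
  finally show ?thesis .
qed

text \<open>The inverse of the edge map, measured from the end \<open>False\<close>; the end
  carrying the strength is thus at position \<open>L\<close>.\<close>

definition path_position :: "real \<Rightarrow> (bool, unit) point \<Rightarrow> real" where
  "path_position L p = (case p of Vertex b \<Rightarrow> if b then L else 0 | Interior _ x \<Rightarrow> x)"

context
  fixes L :: real
  assumes L: "0 < L"
begin

lemma path_position_edge:
  "path_position L (edge_pt path_graph (path_length L) () x) = x"
  using L by (simp add: path_position_def edge_pt_def path_graph_def path_length_def)

lemma edge_path_position:
  assumes "p \<in> points path_graph (path_length L)"
  shows "edge_pt path_graph (path_length L) () (path_position L p) = p" "path_position L p \<in> {0..L}"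
  using assms L
  by (auto simp: path_position_def edge_pt_def path_graph_def path_length_def points_def split: point.splits)

lemma edge_pt_path_points:
  "x \<in> {0..L} \<Longrightarrow> edge_pt path_graph (path_length L) () x \<in> points path_graph (path_length L)"
  by (auto simp: edge_pt_def path_graph_def path_length_def points_def)

lemma graph_dist_path:
  assumes "p \<in> points path_graph (path_length L)" "q \<in> points path_graph (path_length L)"
  shows "graph_dist path_graph (path_length L) p q = \<bar>path_position L p - path_position L q\<bar>"
proof -
  interpret path: metric_graph path_graph "path_length L"
    using L by (rule metric_graph_path)
  have "walk path_graph (path_length L) p q \<bar>path_position L p - path_position L q\<bar>"
    using path.walk_edge[of "()" "path_position L p" "path_position L q"] edge_path_position assms
    by (simp add: path_graph_def path_length_def)
  moreover have "path.edge_lipschitz (path_position L)"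
    by (simp add: path.edge_lipschitz_def path_position_edge)
  ultimately show ?thesis by (rule path.graph_dist_eq)
qed

end

section \<open>The equality case: chains and isometries onto the interval\<close>

context metric_graph
begin

lemma chain_same_graph:
  assumes "chain r (arcs G)"
    and r: "r \<in> verts G" and conn: "\<And>v. v \<in> verts G \<Longrightarrow> (r, v) \<in> (adj (arcs G))\<^sup>*"
    and supp: "\<And>v. v \<in> verts G \<Longrightarrow> v \<noteq> r \<Longrightarrow> \<alpha> v = 0"
  defines "L \<equiv> sum l (arcs G)"
  shows "same_graph G l \<alpha> path_graph (path_length L) (path_strengths 0 (\<alpha> r))"
proof -
  have L: "0 < L" unfolding L_def using arcs_nonempty by (intro sum_length_pos) auto
  have ends: "v = r \<or> (\<exists>e\<in>arcs G. v \<in> {tail G e, head G e})" if "v \<in> verts G" for v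
    using conn[OF that] by (cases rule: rtranclE) (auto simp: adj_def)
  have points: "points G l = chain_points r (arcs G)"
    using ends r by (rule points_eq_edges)
  obtain \<psi> where bij: "bij_betw \<psi> (points G l) {0..L}" and \<psi>r: "\<psi> (Vertex r) = 0"
    and iso: "\<And>e x y. \<lbrakk>e \<in> arcs G; x \<in> {0..l e}; y \<in> {0..l e}\<rbrakk> \<Longrightarrow>
      \<bar>\<psi> (edge_pt G l e x) - \<psi> (edge_pt G l e y)\<bar> = \<bar>x - y\<bar>"
    and walk: "\<And>p q. \<lbrakk>p \<in> points G l; q \<in> points G l\<rbrakk> \<Longrightarrow> walk G l p q \<bar>\<psi> p - \<psi> q\<bar>"
    using chain_position[OF assms(1)] unfolding points L_def by blast
  have "edge_lipschitz \<psi>" using iso by (simp add: edge_lipschitz_def)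
  then have dist: "graph_dist G l p q = \<bar>\<psi> p - \<psi> q\<bar>" if "p \<in> points G l" "q \<in> points G l" for p q
    using walk[OF that] by (intro graph_dist_eq)
  let ?E = "edge_pt path_graph (path_length L) ()"
  \<comment> \<open>The reflection is needed because \<open>r\<close> has position \<open>0\<close>
    in the chain, whereas the strength sits at position \<open>L\<close> of the path graph.\<close>
  define \<phi> where "\<phi> p = ?E (L - \<psi> p)" for p
  have range: "\<psi> p \<in> {0..L}" if "p \<in> points G l" for p
    using bij that by (auto simp: bij_betw_def)
  have rP: "Vertex r \<in> points G l" using r by (simp add: points_def)
  have \<phi>P: "\<phi> p \<in> points path_graph (path_length L)" if "p \<in> points G l" for p
    unfolding \<phi>_def using range[OF that] by (intro edge_pt_path_points[OF L]) auto
  have pos: "path_position L (\<phi> p) = L - \<psi> p" for p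
    unfolding \<phi>_def by (rule path_position_edge[OF L])
  have "bij_betw \<phi> (points G l) (points path_graph (path_length L))"
    unfolding bij_betw_def
  proof
    show "inj_on \<phi> (points G l)"
    proof (rule inj_onI)
      fix p q assume "p \<in> points G l" "q \<in> points G l" "\<phi> p = \<phi> q"
      then show "p = q" using pos[of p] pos[of q] bij_betw_imp_inj_on[OF bij] by (auto dest: inj_onD)
    qed
    show "\<phi> ` points G l = points path_graph (path_length L)"
    proof
      show "points path_graph (path_length L) \<subseteq> \<phi> ` points G l"
      proof
        fix q assume q: "q \<in> points path_graph (path_length L)"
        have "L - path_position L q \<in> \<psi> ` points G l"
          using edge_path_position(2)[OF L q] bij by (auto simp: bij_betw_def)
        then obtain p where p: "p \<in> points G l" "L - path_position L q = \<psi> p" by blast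
        then have "\<phi> p = q" using edge_path_position(1)[OF L q] unfolding \<phi>_def p(2)[symmetric] by simp
        then show "q \<in> \<phi> ` points G l" using p(1) by blast
      qed
    qed (use \<phi>P in blast)
  qed
  moreover have "graph_dist path_graph (path_length L) (\<phi> p) (\<phi> q) = graph_dist G l p q"
    if "p \<in> points G l" "q \<in> points G l" for p q
    using graph_dist_path[OF L \<phi>P[OF that(1)] \<phi>P[OF that(2)]] dist[OF that] by (simp add: pos)
  moreover have "strength_at (path_strengths 0 (\<alpha> r)) (\<phi> p) = strength_at \<alpha> p" if p: "p \<in> points G l" for p
  proof (cases "p = Vertex r")
    case True
    then show ?thesis
      using L by (simp add: \<phi>_def \<psi>r edge_pt_def path_graph_def path_length_def path_strengths_def)
  next
    case False
    \<comment> \<open>By injectivity no point other than \<open>Vertex r\<close> is mapped to the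
      end with strength.\<close>
    then have "\<psi> p \<noteq> 0" using inj_onD[OF bij_betw_imp_inj_on[OF bij], of p "Vertex r"] \<psi>r p rP by auto
    then have "strength_at (path_strengths 0 (\<alpha> r)) (\<phi> p) = 0"
      by (simp add: \<phi>_def edge_pt_def path_graph_def path_length_def path_strengths_def)
    moreover have "strength_at \<alpha> p = 0" using False p supp by (cases p) (auto simp: points_def)
    ultimately show ?thesis by simp
  qed
  ultimately show ?thesis unfolding same_graph_def by blast
qed

text \<open>The isometry followed by the reflected coordinate of the interval is an embedding to
  which \<open>isometric_edge_mass_ge\<close> applies.\<close>

lemma same_graph_edge_mass_ge:
  assumes pos: "\<And>v. v \<in> verts G \<Longrightarrow> 0 \<le> \<alpha> v"
    and c: "torsion_values \<alpha> c"
  defines "L \<equiv> sum l (arcs G)" and "A \<equiv> sum \<alpha> (verts G)"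
  assumes A: "A \<noteq> 0" and same: "same_graph G l \<alpha> path_graph (path_length L) (path_strengths 0 A)"
  shows "L ^ 3 / 3 + L\<^sup>2 / A \<le> edge_mass c (arcs G)"
proof -
  have L: "0 < L" unfolding L_def using arcs_nonempty by (intro sum_length_pos) auto
  obtain \<phi> where bij: "bij_betw \<phi> (points G l) (points path_graph (path_length L))"
    and dist: "\<And>p q. p \<in> points G l \<Longrightarrow> q \<in> points G l \<Longrightarrow>
      graph_dist path_graph (path_length L) (\<phi> p) (\<phi> q) = graph_dist G l p q"
    and strength: "\<And>p. p \<in> points G l \<Longrightarrow> strength_at (path_strengths 0 A) (\<phi> p) = strength_at \<alpha> p"
    using same unfolding same_graph_def by blast
  define \<psi> where "\<psi> p = L - path_position L (\<phi> p)" for p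
  have \<phi>P: "\<phi> p \<in> points path_graph (path_length L)" if "p \<in> points G l" for p
    using bij that by (auto simp: bij_betw_def)
  have "inj_on \<psi> (points G l)"
  proof (rule inj_onI)
    fix p q assume pq: "p \<in> points G l" "q \<in> points G l" "\<psi> p = \<psi> q"
    then have "path_position L (\<phi> p) = path_position L (\<phi> q)" by (simp add: \<psi>_def)
    then have "\<phi> p = \<phi> q" by (metis edge_path_position(1)[OF L] \<phi>P pq(1,2))
    then show "p = q" using pq inj_onD[OF bij_betw_imp_inj_on[OF bij]] by blast
  qed
  moreover have "\<bar>\<psi> p - \<psi> q\<bar> = graph_dist G l p q" if "p \<in> points G l" "q \<in> points G l" for p q
    using graph_dist_path[OF L \<phi>P[OF that(1)] \<phi>P[OF that(2)]] dist[OF that]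
    by (simp add: \<psi>_def abs_minus_commute)
  moreover have "\<psi> p \<in> {0..L}" if "p \<in> points G l" for p
    using edge_path_position(2)[OF L \<phi>P[OF that]] by (simp add: \<psi>_def)
  \<comment> \<open>Preservation of strengths sends such a vertex to the end \<open>True\<close>,
    which the reflection places at \<open>0\<close>.\<close>
  moreover have "\<psi> (Vertex v) = 0" if "v \<in> verts G" "\<alpha> v \<noteq> 0" for v
    using strength[of "Vertex v"] that
    by (cases "\<phi> (Vertex v)") (auto simp: points_def \<psi>_def path_position_def path_strengths_def split: if_splits)
  ultimately show ?thesis
    using isometric_edge_mass_ge[OF pos c] A unfolding L_def A_def by blast
qed

end

theorem theorem8p2:
  fixes G :: "('v, 'e) pre_digraph" and l :: "'e \<Rightarrow> real" and \<alpha> :: "'v \<Rightarrow> real"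
  assumes "metric_graph G l"
    and "connected_graph G l"
    and "\<forall>v\<in>verts G. 0 \<le> \<alpha> v"
    and "\<exists>v\<in>verts G. \<alpha> v \<noteq> 0"
  defines "len \<equiv> total_length G l"
    and "A \<equiv> \<Sum>v\<in>verts G. \<alpha> v"
  shows "torsional_rigidity G l \<alpha>
           \<le> torsional_rigidity path_graph (path_length len) (path_strengths 0 A)
       \<and> torsional_rigidity path_graph (path_length len) (path_strengths 0 A)
           = len ^ 3 / 3 + len\<^sup>2 / A
       \<and> (torsional_rigidity G l \<alpha>
            = torsional_rigidity path_graph (path_length len) (path_strengths 0 A)
          \<longleftrightarrow> same_graph G l \<alpha> path_graph (path_length len) (path_strengths 0 A))"
proof -
  interpret metric_graph G l by (rule assms(1))
  have len: "len = sum l (arcs G)" by (simp add: len_def total_length_def)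
  have "0 < len" unfolding len using arcs_nonempty by (intro sum_length_pos) auto
  have pos: "\<And>v. v \<in> verts G \<Longrightarrow> 0 \<le> \<alpha> v" using assms(3) by blast
  obtain r where r: "r \<in> verts G" "\<alpha> r \<noteq> 0" using assms(4) by blast
  have "0 < A"
    unfolding A_def using pos r by (intro sum_pos2[of _ r]) (auto simp: less_le)
  have conn: "\<And>u v. u \<in> verts G \<Longrightarrow> v \<in> verts G \<Longrightarrow> (u, v) \<in> (adj (arcs G))\<^sup>*"
    using connected_graph_adj[OF assms(2)] .
  obtain c where c: "torsion_values \<alpha> c"
    using torsion_values_exist[where \<alpha> = \<alpha>, OF pos r conn[OF r(1)]] .
  have T: "torsional_rigidity G l \<alpha> = edge_mass c (arcs G)"
    unfolding edge_mass_def by (rule torsional_rigidity_eq[where \<alpha> = \<alpha>, OF pos r conn[OF r(1)] c])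
  have TJ: "torsional_rigidity path_graph (path_length len) (path_strengths 0 A) = len ^ 3 / 3 + len\<^sup>2 / A"
    using \<open>0 < len\<close> \<open>0 < A\<close> by (rule torsional_rigidity_path)
  have bound: "edge_mass c (arcs G) \<le> len ^ 3 / 3 + len\<^sup>2 / A"
    unfolding A_def len by (rule edge_mass_upper_bound(1)[where \<alpha> = \<alpha>, OF pos r conn c])
  have "same_graph G l \<alpha> path_graph (path_length len) (path_strengths 0 A)"
    if "edge_mass c (arcs G) = len ^ 3 / 3 + len\<^sup>2 / A"
  proof -
    have "chain r (arcs G) \<and> (\<forall>v\<in>verts G. v \<noteq> r \<longrightarrow> \<alpha> v = 0)"
      using that unfolding A_def len
      by (intro edge_mass_upper_bound(2)[where \<alpha> = \<alpha>, OF pos r conn c])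
    then have *: "chain r (arcs G)" "\<And>v. v \<in> verts G \<Longrightarrow> v \<noteq> r \<Longrightarrow> \<alpha> v = 0" by auto
    have "A = \<alpha> r"
      unfolding A_def using sum.remove[OF finite_verts r(1), of \<alpha>] *(2) by simp
    then show ?thesis
      using chain_same_graph[where \<alpha> = \<alpha>, OF *(1) r(1) conn[OF r(1)] *(2)] by (simp add: len)
  qed
  \<comment> \<open>Only this inequality has to be shown, since \<open>bound\<close> turns it into
    equality.\<close>
  moreover have "len ^ 3 / 3 + len\<^sup>2 / A \<le> edge_mass c (arcs G)"
    if "same_graph G l \<alpha> path_graph (path_length len) (path_strengths 0 A)"
    using same_graph_edge_mass_ge[where \<alpha> = \<alpha>, OF pos c] that \<open>0 < A\<close> unfolding A_def len by simp
  ultimately show ?thesis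
    unfolding T TJ using bound by (metis antisym)
qed

end
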